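(* Let $\varepsilon > 0$ be a constant and consider the random graph process $\{G_i\}_{i=0}^{\binom{n}{2}}$ on $n$ vertices. Then with high probability (as $n\to\infty$) the following holds simultaneously for every integer $m$ with $\frac{1+\varepsilon}{6}\, n\log n \le m \le \binom{n}{2}$: the giant (largest connected component) of $G_m$ is $(1/2-\varepsilon)$-resilient with respect to connectivity.
   Context: Random graph process: $G_0$ is the empty graph on $n$ vertices; for each $i\in\{1,\dots,\binom n2\}$, $G_i$ is obtained from $G_{i-1}$ by adding an edge $e\notin E(G_{i-1})$ chosen uniformly at random among the missing edges. Thus $\{G_i\}$ is a random nested sequence ending in the complete graph. With high probability: with probability tending to $1$ as $n\to\infty$. $\log$ is the natural logarithm. The giant of a graph is its largest connected component (regarded as a graph on its own vertex set). $\alpha$-resilience: Let $G=(V,E)$ be a graph, $\mathcal P$ a monotone increasing graph property, and $\alpha$ a real constant. $G$ is $\alpha$-resilient with respect to $\mathcal P$ if for every spanning subgraph $H\subseteq G$ satisfying $\deg_H(v)\le \alpha\deg_G(v)$ for all $v\in V$, we have $G-H\in\mathcal P$, where $G-H$ is the graph on $V$ with edge set $E(G)\setminus E(H)$. *)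

theory Defs
  imports "HOL-Probability.Probability" "HOL-Library.Ramsey"
begin

text \<open>
  A finite simple graph is given by a vertex set \<open>V\<close> and an edge set \<open>E \<subseteq> nsets V 2\<close>,
  i.e. edges are two-element subsets of \<open>V\<close>.
\<close>

definition degree_in :: "'a set set \<Rightarrow> 'a \<Rightarrow> nat" where
  "degree_in E v = card {e \<in> E. v \<in> e}"

definition adj :: "'a set set \<Rightarrow> ('a \<times> 'a) set" where
  "adj E = {(u, v). {u, v} \<in> E}"

definition connected_graph :: "'a set \<Rightarrow> 'a set set \<Rightarrow> bool" where
  "connected_graph V E \<longleftrightarrow> V \<noteq> {} \<and> (\<forall>u\<in>V. \<forall>v\<in>V. (u, v) \<in> (adj E)\<^sup>*)"

definition components :: "'a set \<Rightarrow> 'a set set \<Rightarrow> 'a set set" where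
  "components V E = {{v \<in> V. (u, v) \<in> (adj E)\<^sup>*} | u. u \<in> V}"

definition largest_component :: "'a set \<Rightarrow> 'a set set \<Rightarrow> 'a set \<Rightarrow> bool" where
  "largest_component V E C \<longleftrightarrow>
     C \<in> components V E \<and> (\<forall>D \<in> components V E. card D \<le> card C)"

definition induced_edges :: "'a set set \<Rightarrow> 'a set \<Rightarrow> 'a set set" where
  "induced_edges E C = {e \<in> E. e \<subseteq> C}"

definition monotone_increasing :: "('a set \<Rightarrow> 'a set set \<Rightarrow> bool) \<Rightarrow> bool" where
  "monotone_increasing P \<longleftrightarrow>
     (\<forall>V E F. E \<subseteq> F \<longrightarrow> F \<subseteq> nsets V 2 \<longrightarrow> P V E \<longrightarrow> P V F)"

text \<open>
  A spanning subgraph of \<open>(V, E)\<close> is determined by its edge set \<open>H \<subseteq> E\<close>.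
  Resilience is only meant for monotone increasing properties \<open>P\<close>; connectivity is one.
\<close>

definition resilient ::
    "real \<Rightarrow> ('a set \<Rightarrow> 'a set set \<Rightarrow> bool) \<Rightarrow> 'a set \<Rightarrow> 'a set set \<Rightarrow> bool" where
  "resilient \<alpha> P V E \<longleftrightarrow>
     (\<forall>H. H \<subseteq> E \<and> (\<forall>v\<in>V. real (degree_in H v) \<le> \<alpha> * real (degree_in E v))
        \<longrightarrow> P V (E - H))"

lemma monotone_increasing_connected_graph: "monotone_increasing connected_graph"
proof -
  have "(adj E)\<^sup>* \<subseteq> (adj F)\<^sup>*" if "E \<subseteq> F" for E F :: "'a set set"
    using that by (intro rtrancl_mono) (auto simp: adj_def)
  then show ?thesis
    unfolding monotone_increasing_def connected_graph_def by blast
qed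

text \<open>
  \<open>graph_process n i\<close> is the joint law of the edge sets \<open>[G\<^sub>0, \<dots>, G\<^sub>i]\<close> on the vertex
  set \<open>{..<n}\<close>. It is meaningful for \<open>i \<le> n choose 2\<close> only: beyond that no edge is
  missing, and \<open>pmf_of_set {}\<close> is unspecified.
\<close>

primrec graph_process :: "nat \<Rightarrow> nat \<Rightarrow> nat set set list pmf" where
  "graph_process n 0 = return_pmf [{}]"
| "graph_process n (Suc i) =
     bind_pmf (graph_process n i) (\<lambda>Gs.
       map_pmf (\<lambda>e. Gs @ [insert e (last Gs)])
         (pmf_of_set (nsets {..<n} 2 - last Gs)))"

end

theory Submission
  imports Defs "HOL-Real_Asymp.Real_Asymp"
begin

text \<open>
  If deleting \<open>H\<close> disconnects a component, one of the resulting pieces \<open>S\<close> has at most \<open>n / 2\<close>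
  vertices, is connected, and has few boundary edges compared with its inner edges; moreover some
  vertex of \<open>S\<close> has two neighbours in \<open>S\<close>, since a vertex keeps more than half of its edges.
  For \<open>S\<close> with more than 48 vertices a weighted first moment bound is polynomially small enough
  for a union bound over all \<open>m\<close>. A smaller \<open>S\<close> contains a path on three vertices with bounded
  boundary, which costs \<open>exp (- 3 n p)\<close>, about \<open>n powr (- 1 - \<epsilon>)\<close> at the threshold, so a union
  bound over \<open>m\<close> is too expensive. Boundaries only grow along the process. Hence no such path exists
  after time \<open>n ln n\<close> if none of the triples has a bounded boundary at that time; and before, the path
  is present at the start or is completed by one of the \<open>O(n ln n)\<close> new edges, each of which hits a
  prescribed pair with probability \<open>O(n powr - 2)\<close>.
\<close>

subsection \<open>Uniformly random subsets of fixed size\<close>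

text \<open>The constant 1 / 6 comes from paths on three vertices. With edge density p there are
  about n^3 p^2 of them, which is n up to logarithms when n p is of order ln n, and 3 n p is about
  (1 + \<epsilon>) ln n at the starting time m = (1 + \<epsilon>) / 6 * n ln n. So the expected
  number of paths with bounded boundary is n powr (- \<epsilon>) up to logarithms, and no polynomial
  loss is affordable. Two tools are therefore used: a direct count of m-edge graphs with only
  logarithmic loss for triples, and the lossy but simpler comparison with independent edges for
  larger sets. Single vertices and single edges must be excluded by structure: at costs exp (- n p)
  and exp (- 2 n p) a union bound would diverge. This is where \<alpha> < 1 / 2 enters, since a
  vertex can lose an edge only if its degree is at least 3. The estimate covers every component,
  because a cut is extracted inside any of them; the giant is a special case.\<close>

lemma binomial_mode:
  fixes N m :: nat
  assumes "m \<le> N"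
  shows "1 \<le> (real N + 1) * (real (N choose m) * (real m / real N) ^ m * (1 - real m / real N) ^ (N - m))"
proof (cases "N = 0")
  case True
  then show ?thesis using assms by simp
next
  case False
  \<comment> \<open>\<open>t k\<close> is the point mass at k of the binomial distribution with
    parameters N and m / N, scaled by N ^ N to stay in the naturals. Cross-multiplied, the ratio of
    neighbouring terms compares m (N - k) with (k + 1) (N - m), so the terms increase up to m and
    decrease afterwards. The largest of N + 1 masses with sum 1 is at least 1 / (N + 1).\<close>
  define t where "t k = (N choose k) * m ^ k * (N - m) ^ (N - k)" for k
  have up: "t k \<le> t (Suc k)" if "k < m" for k
  proof -
    have kN: "k < N" using that assms by simp
    have "Suc k * (N - m) \<le> m * (N - k)" using that assms by (intro mult_mono) auto
    then have "Suc k * (N - m) * (N choose k) \<le> m * (N - k) * (N choose k)" by simp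
    also have "\<dots> = m * (Suc k * (N choose Suc k))"
      by (metis mult.assoc binomial_absorb_comp binomial_absorption)
    finally have "(N - m) * (N choose k) \<le> m * (N choose Suc k)"
      by (metis (no_types, opaque_lifting) Suc_mult_le_cancel1 mult.assoc mult.left_commute)
    then have "(N - m) * (N choose k) * (m ^ k * (N - m) ^ (N - Suc k))
       \<le> m * (N choose Suc k) * (m ^ k * (N - m) ^ (N - Suc k))" by (rule mult_right_mono) simp
    moreover have "(N - m) ^ (N - k) = (N - m) * (N - m) ^ (N - Suc k)"
      using kN by (metis Suc_diff_Suc power_Suc)
    ultimately show ?thesis unfolding t_def by (simp add: mult_ac)
  qed
  have down: "t (Suc k) \<le> t k" if "m \<le> k" "k < N" for k
  proof -
    have "m * (N - k) \<le> Suc k * (N - m)" using that assms by (intro mult_mono) auto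
    then have "m * (N - k) * (N choose k) \<le> Suc k * (N - m) * (N choose k)" by simp
    moreover have "m * (N - k) * (N choose k) = m * (Suc k * (N choose Suc k))"
      by (metis mult.assoc binomial_absorb_comp binomial_absorption)
    ultimately have "m * (N choose Suc k) \<le> (N - m) * (N choose k)"
      by (metis (no_types, opaque_lifting) Suc_mult_le_cancel1 mult.assoc mult.left_commute)
    then have "m * (N choose Suc k) * (m ^ k * (N - m) ^ (N - Suc k))
       \<le> (N - m) * (N choose k) * (m ^ k * (N - m) ^ (N - Suc k))" by (rule mult_right_mono) simp
    moreover have "(N - m) ^ (N - k) = (N - m) * (N - m) ^ (N - Suc k)"
      using that by (metis Suc_diff_Suc power_Suc)
    ultimately show ?thesis unfolding t_def by (simp add: mult_ac)
  qed
  have le: "t k \<le> t m" if "k \<le> N" for k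
  proof (cases "k \<le> m")
    case True
    then show ?thesis
      by (induction rule: inc_induct) (auto intro: order_trans[OF up])
  next
    case False
    then have "m \<le> k" by simp
    then show ?thesis using that
      by (induction rule: dec_induct) (auto intro: order_trans[OF down])
  qed
  have "real (N ^ N) = real (\<Sum>k\<le>N. t k)"
    using binomial[of m "N - m" N] assms by (simp add: t_def)
  also have "\<dots> \<le> real (\<Sum>k\<le>N. t m)"
    using le by (intro of_nat_mono sum_mono) auto
  finally have "real N ^ N \<le> (real N + 1) * real (t m)" by (simp add: algebra_simps)
  moreover have "real (t m) = real N ^ N *
      (real (N choose m) * (real m / real N) ^ m * (1 - real m / real N) ^ (N - m))"
  proof -
    have "1 - real m / real N = real (N - m) / real N" using assms False by (simp add: field_simps of_nat_diff)
    then show ?thesis using False assms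
      by (simp add: t_def power_divide field_simps power_add[symmetric])
  qed
  moreover have "real N ^ N > 0" using False by simp
  ultimately have "real N ^ N * 1 \<le> real N ^ N * ((real N + 1) * (real (N choose m) * (real m / real N) ^ m * (1 - real m / real N) ^ (N - m)))"
    by (simp add: mult_ac)
  then show ?thesis using \<open>real N ^ N > 0\<close> by (simp only: mult_le_cancel_left_pos)
qed

text \<open>Comparison with the binomial random subset of density \<open>p\<close>, which has exactly \<open>m\<close> elements
  with probability at least \<open>1 / (N + 1)\<close> because \<open>m\<close> is its mode. The polynomial loss is
  harmless for cuts of more than a bounded number of vertices.\<close>

lemma sum_prod_nsets_le:
  fixes x :: "'a \<Rightarrow> real"
  assumes "finite E" "m \<le> card E" and x: "\<And>e. e \<in> E \<Longrightarrow> x e \<ge> 0"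
  defines "p \<equiv> real m / real (card E)"
  shows "(\<Sum>G\<in>nsets E m. \<Prod>e\<in>G. x e)
           \<le> (real (card E) + 1) * real (card E choose m) * (\<Prod>e\<in>E. 1 + p * (x e - 1))"
proof -
  define N where "N = card E"
  define S where "S = (\<Sum>G\<in>nsets E m. \<Prod>e\<in>G. x e)"
  have p: "0 \<le> p" "p \<le> 1" using assms by (auto simp: p_def divide_le_eq)
  have S0: "S \<ge> 0" unfolding S_def using x by (intro sum_nonneg prod_nonneg) (auto simp: nsets_def)
  \<comment> \<open>The factor is the mass of a single m-set in the binomial model. The sum is then
    the part of size m of the expansion of a product over \<open>E\<close>, and enlarging it to all
    subsets only adds nonnegative terms.\<close>
  have "S * (p ^ m * (1 - p) ^ (N - m)) = (\<Sum>G\<in>nsets E m. (\<Prod>e\<in>G. p * x e) * (\<Prod>e\<in>E-G. 1 - p))"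
    unfolding S_def sum_distrib_right
    by (rule sum.cong) (auto simp: nsets_def prod.distrib card_Diff_subset N_def)
  also have "\<dots> \<le> (\<Sum>G\<in>Pow E. (\<Prod>e\<in>G. p * x e) * (\<Prod>e\<in>E-G. 1 - p))"
    using assms p by (intro sum_mono2) (auto simp: nsets_def intro!: mult_nonneg_nonneg prod_nonneg)
  also have "\<dots> = (\<Prod>e\<in>E. p * x e + (1 - p))"
    using assms by (simp add: prod_add)
  also have "\<dots> = (\<Prod>e\<in>E. 1 + p * (x e - 1))"
    by (simp add: algebra_simps)
  finally have 1: "S * (p ^ m * (1 - p) ^ (N - m)) \<le> (\<Prod>e\<in>E. 1 + p * (x e - 1))" .
  have "S * 1 \<le> S * ((real N + 1) * (real (N choose m) * p ^ m * (1 - p) ^ (N - m)))"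
    using binomial_mode[of m N] assms S0 unfolding p_def N_def by (intro mult_left_mono) auto
  also have "\<dots> = ((real N + 1) * real (N choose m)) * (S * (p ^ m * (1 - p) ^ (N - m)))"
    by (simp add: mult_ac)
  also have "\<dots> \<le> ((real N + 1) * real (N choose m)) * (\<Prod>e\<in>E. 1 + p * (x e - 1))"
    by (intro mult_left_mono 1) auto
  finally show ?thesis unfolding S_def N_def by simp
qed

text \<open>Markov's inequality for the weight with a factor \<open>y\<close> per edge in
  \<open>A\<close> and \<open>x\<close> per edge in \<open>B\<close>. For cuts, \<open>A\<close>
  holds the inner pairs, with weight at least 1, and \<open>B\<close> the boundary pairs, with
  weight below 1. The binomial coefficient from the sum over m-sets cancels against the uniform
  probability.\<close>

lemma prob_weighted_counts_le:
  fixes x y :: real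
  assumes E: "finite E" "m \<le> card E" and AB: "A \<subseteq> E" "B \<subseteq> E" "A \<inter> B = {}"
    and xy: "x > 0" "y > 0"
  defines "p \<equiv> real m / real (card E)"
  shows "measure_pmf.prob (pmf_of_set (nsets E m))
           {G. y ^ card (G \<inter> A) * x ^ card (G \<inter> B) \<ge> t} * t
         \<le> (real (card E) + 1) * exp (p * ((y - 1) * real (card A) + (x - 1) * real (card B)))"
proof -
  define w where "w e = (if e \<in> A then y else if e \<in> B then x else 1)" for e
  define c where "c = real (card E choose m)"
  have cpos: "c > 0" using E by (simp add: c_def)
  have p: "0 \<le> p" "p \<le> 1" using assms by (auto simp: p_def divide_le_eq)
  have fin: "finite (nsets E m)" using E by (simp add: finite_imp_finite_nsets)
  have ne: "nsets E m \<noteq> {}" using E by (metis card_nsets card.empty binomial_eq_0_iff not_less)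
  let ?Q = "{G. y ^ card (G \<inter> A) * x ^ card (G \<inter> B) \<ge> t}"
  have w: "(\<Prod>e\<in>G. w e) = y ^ card (G \<inter> A) * x ^ card (G \<inter> B)" if "finite G" for G
  proof -
    have "(\<Prod>e\<in>G. w e) = (\<Prod>e\<in>G. (if e \<in> A then y else 1) * (if e \<in> B then x else 1))"
      using AB by (intro prod.cong) (auto simp: w_def)
    also have "\<dots> = y ^ card (G \<inter> A) * x ^ card (G \<inter> B)"
      using that by (simp add: prod.distrib prod.inter_restrict[symmetric] Int_def)
    finally show ?thesis .
  qed
  have "real (card (nsets E m \<inter> ?Q)) * t = (\<Sum>G\<in>nsets E m \<inter> ?Q. t)" by simp
  also have "\<dots> \<le> (\<Sum>G\<in>nsets E m \<inter> ?Q. \<Prod>e\<in>G. w e)"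
    by (intro sum_mono) (auto simp: w nsets_def)
  also have "\<dots> \<le> (\<Sum>G\<in>nsets E m. \<Prod>e\<in>G. w e)"
    using fin xy by (intro sum_mono2) (auto intro!: prod_nonneg simp: w_def)
  also have "\<dots> \<le> (real (card E) + 1) * real (card E choose m) * (\<Prod>e\<in>E. 1 + p * (w e - 1))"
    unfolding p_def using E xy by (intro sum_prod_nsets_le) (auto simp: w_def)
  also have "\<dots> \<le> (real (card E) + 1) * real (card E choose m) * (\<Prod>e\<in>E. exp (p * (w e - 1)))"
  proof (intro mult_left_mono prod_mono conjI)
    fix e
    have "p * w e \<ge> 0" using p xy by (simp add: w_def)
    then show "0 \<le> 1 + p * (w e - 1)" using p by (simp add: algebra_simps)
  qed (use exp_ge_add_one_self in auto)
  also have "(\<Prod>e\<in>E. exp (p * (w e - 1))) = exp (\<Sum>e\<in>E. p * (w e - 1))"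
    using E by (simp add: exp_sum)
  also have "(\<Sum>e\<in>E. p * (w e - 1)) = p * (\<Sum>e\<in>E. w e - 1)" by (simp add: sum_distrib_left)
  also have "(\<Sum>e\<in>E. w e - 1) = (\<Sum>e\<in>E. (if e \<in> A then y - 1 else 0) + (if e \<in> B then x - 1 else 0))"
    using AB by (intro sum.cong) (auto simp: w_def)
  also have "\<dots> = (y - 1) * real (card A) + (x - 1) * real (card B)"
    using AB E by (simp add: sum.distrib sum.inter_restrict[symmetric] Int_absorb1)
  finally have *: "real (card (nsets E m \<inter> ?Q)) * t \<le> (real (card E) + 1) * c *
      exp (p * ((y - 1) * real (card A) + (x - 1) * real (card B)))" by (simp add: c_def)
  have "measure_pmf.prob (pmf_of_set (nsets E m)) ?Q * t = real (card (nsets E m \<inter> ?Q)) * t / c"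
    using fin ne E by (simp add: measure_pmf_of_set c_def)
  also have "\<dots> \<le> (real (card E) + 1) * exp (p * ((y - 1) * real (card A) + (x - 1) * real (card B)))"
    using * cpos by (simp add: divide_le_eq mult_ac)
  finally show ?thesis .
qed

text \<open>Divided by \<open>N choose m\<close>, the left side is the probability that a uniform
  m-set contains g given elements. Revealing them one at a time gives factors (m - i) / (N - i),
  none larger than m / N.\<close>

lemma binomial_diff_both_le:
  assumes "g \<le> m" "m \<le> N"
  shows "real ((N - g) choose (m - g)) \<le> (real m / real N) ^ g * real (N choose m)"
  using assms(1)
proof (induction g)
  case (Suc g)
  have g: "Suc g \<le> m" "Suc g \<le> N" using Suc assms by auto
  have "(m - g) * ((N - g) choose (m - g)) = (N - g) * ((N - Suc g) choose (m - Suc g))"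
    using g binomial_absorption[of "m - Suc g" "N - g"] by (simp add: Suc_diff_Suc)
  then have "real (m - g) * real ((N - g) choose (m - g)) = real (N - g) * real ((N - Suc g) choose (m - Suc g))"
    by (metis of_nat_mult)
  then have "real ((N - Suc g) choose (m - Suc g)) = real (m - g) / real (N - g) * real ((N - g) choose (m - g))"
    using g by (simp add: field_simps)
  also have "\<dots> \<le> real m / real N * real ((N - g) choose (m - g))"
  proof (intro mult_right_mono)
    have "real g * real m \<le> real g * real N" using assms by (intro mult_left_mono) auto
    then have "(real m - real g) * real N \<le> real m * (real N - real g)" by (simp add: algebra_simps)
    then show "real (m - g) / real (N - g) \<le> real m / real N"
      using g by (simp add: divide_le_eq le_divide_eq of_nat_diff frac_le_eq divide_simps)
  qed simp
  also have "\<dots> \<le> real m / real N * ((real m / real N) ^ g * real (N choose m))"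
    using Suc by (intro mult_left_mono) auto
  finally show ?case by (simp add: mult_ac)
qed simp

text \<open>Here the quotient is the probability that a uniform k-set avoids d given elements. Each
  further element costs a factor 1 - k / (M - i), at most 1 - k / M; once fewer than k elements are
  left, the coefficient is 0.\<close>

lemma binomial_diff_upper_le:
  assumes "d \<le> M" "k \<le> M"
  shows "real ((M - d) choose k) \<le> (1 - real k / real M) ^ d * real (M choose k)"
  using assms(1)
proof (induction d)
  case (Suc d)
  have k1: "0 \<le> 1 - real k / real M" using assms by (auto simp: divide_le_eq)
  show ?case
  proof (cases "k \<le> M - d")
    case True
    have d: "d < M" using Suc by simp
    have "(M - d - k) * ((M - d) choose k) = (M - d) * ((M - Suc d) choose k)"
      using binomial_absorb_comp[of "M - d" k] by simp
    then have "real (M - d - k) * real ((M - d) choose k) = real (M - d) * real ((M - Suc d) choose k)"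
      by (metis of_nat_mult)
    then have "real ((M - Suc d) choose k) = (1 - real k / real (M - d)) * real ((M - d) choose k)"
      using d True by (simp add: field_simps of_nat_diff)
    also have "\<dots> \<le> (1 - real k / real M) * real ((M - d) choose k)"
      using d by (intro mult_right_mono diff_left_mono divide_left_mono) auto
    also have "\<dots> \<le> (1 - real k / real M) * ((1 - real k / real M) ^ d * real (M choose k))"
      using Suc k1 by (intro mult_left_mono) auto
    finally show ?thesis by (simp add: mult_ac)
  next
    case False
    then have z: "(M - Suc d) choose k = 0" by (simp add: binomial_eq_0)
    have "0 \<le> (1 - real k / real M) ^ Suc d * real (M choose k)" using k1 by (intro mult_nonneg_nonneg zero_le_power) auto
    then show ?thesis unfolding z by simp
  qed
qed simp

text \<open>Among a special elements, g prescribed ones must be present and the others absent: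
  containment is paid first in the full set, then avoidance in the N - g remaining elements.
  Replacing N - g by N in the exponent only weakens the bound.\<close>

lemma binomial_diff_le_exp:
  assumes "g \<le> a" "a \<le> N" "g \<le> m" "m \<le> N"
  shows "real ((N - a) choose (m - g))
    \<le> (real m / real N) ^ g * exp (- (real (m - g) * real (a - g) / real N)) * real (N choose m)"
proof (cases "N = g")
  case True
  then show ?thesis using assms by simp
next
  case False
  then have gN: "g < N" using assms by simp
  have "1 - real (m - g) / real (N - g) \<le> exp (- (real (m - g) / real (N - g)))"
    using exp_ge_add_one_self[of "- (real (m - g) / real (N - g))"] by simp
  moreover have "0 \<le> 1 - real (m - g) / real (N - g)" using assms gN by (simp add: divide_le_eq)
  ultimately have "(1 - real (m - g) / real (N - g)) ^ (a - g) \<le> exp (- (real (m - g) / real (N - g))) ^ (a - g)"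
    by (intro power_mono) auto
  also have "\<dots> = exp (- (real (m - g) * real (a - g) / real (N - g)))"
    by (simp add: exp_of_nat_mult[symmetric] mult_ac)
  also have "\<dots> \<le> exp (- (real (m - g) * real (a - g) / real N))"
    using gN by (auto intro!: divide_left_mono)
  finally have 1: "(1 - real (m - g) / real (N - g)) ^ (a - g) \<le> exp (- (real (m - g) * real (a - g) / real N))" .
  have "real ((N - a) choose (m - g)) = real ((N - g - (a - g)) choose (m - g))" using assms by simp
  also have "\<dots> \<le> (1 - real (m - g) / real (N - g)) ^ (a - g) * real ((N - g) choose (m - g))"
    using assms by (intro binomial_diff_upper_le) auto
  also have "\<dots> \<le> exp (- (real (m - g) * real (a - g) / real N)) * ((real m / real N) ^ g * real (N choose m))"
    using assms by (intro mult_mono 1 binomial_diff_both_le) auto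
  finally show ?thesis by (simp add: mult_ac)
qed

text \<open>Unlike the comparison with the binomial model, the union over the trace \<open>G \<inter> B\<close> loses
  only a power of \<open>card B * p\<close>; configurations on three vertices cannot afford more.\<close>

lemma prob_superset_few_le:
  assumes E: "finite E" "m \<le> card E" and FB: "F \<subseteq> E" "B \<subseteq> E" "F \<inter> B = {}"
  defines "p \<equiv> real m / real (card E)"
  shows "measure_pmf.prob (pmf_of_set (nsets E m)) {G. F \<subseteq> G \<and> card (G \<inter> B) \<le> k}
    \<le> (real k + 1) * (1 + real (card B) * p) ^ k * p ^ card F * exp (2 * real k + real (card F))
       * exp (- (real (card B) * p))"
proof -
  define N f b where "N = card E" and "f = card F" and "b = card B"
  define c where "c = real (N choose m)"
  have cpos: "c > 0" using E by (simp add: c_def N_def)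
  have p: "0 \<le> p" "p \<le> 1" using assms by (auto simp: p_def divide_le_eq)
  have fin: "finite (nsets E m)" using E by (simp add: finite_imp_finite_nsets)
  have ne: "nsets E m \<noteq> {}" using E by (metis card_nsets card.empty binomial_eq_0_iff not_less)
  have finFB: "finite F" "finite B" using E FB by (auto intro: finite_subset)
  have bN: "f + b \<le> N"
    using card_mono[of E "F \<union> B"] E FB finFB by (simp add: f_def b_def N_def card_Un_disjoint)
  let ?Q = "{G. F \<subseteq> G \<and> card (G \<inter> B) \<le> k}"
  define W where "W J = {G \<in> nsets E m. F \<union> J \<subseteq> G \<and> G \<inter> (B - J) = {}}" for J
  define u where "u = p ^ f * exp (2 * real k + real f) * exp (- (real b * p))"
  have W: "real (card (W J)) \<le> p ^ card J * u * c" if J: "J \<subseteq> B" "card J \<le> k" for J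
  proof -
    define j where "j = card J"
    have finJ: "finite J" using J finFB finite_subset by auto
    have jb: "j \<le> b" using J finFB by (simp add: j_def b_def card_mono)
    have FJ: "card (F \<union> J) = f + j" using finFB finJ FB J by (subst card_Un_disjoint) (auto simp: f_def j_def)
    show ?thesis
    proof (cases "f + j \<le> m")
      case False
      have "W J = {}"
      proof (rule ccontr)
        assume "W J \<noteq> {}"
        then obtain G where G: "G \<subseteq> E" "finite G" "card G = m" "F \<union> J \<subseteq> G" by (auto simp: W_def nsets_def)
        then show False using card_mono[of G "F \<union> J"] False FJ by simp
      qed
      then show ?thesis using p cpos by (simp add: u_def)
    next
      case True
      have "card (W J) \<le> card (nsets (E - (F \<union> B)) (m - (f + j)))"
      proof (rule card_inj_on_le[where f = "\<lambda>G. G - (F \<union> J)"])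
        show "inj_on (\<lambda>G. G - (F \<union> J)) (W J)"
          by (rule inj_onI) (auto simp: W_def)
        show "(\<lambda>G. G - (F \<union> J)) ` W J \<subseteq> nsets (E - (F \<union> B)) (m - (f + j))"
          using finFB finJ by (auto simp: W_def nsets_def card_Diff_subset FJ)
        show "finite (nsets (E - (F \<union> B)) (m - (f + j)))"
          using E by (simp add: finite_imp_finite_nsets)
      qed
      also have "\<dots> = (N - (f + b)) choose (m - (f + j))"
        using FB finFB by (simp add: card_Diff_subset card_Un_disjoint N_def f_def b_def)
      finally have "real (card (W J)) \<le> real ((N - (f + b)) choose (m - (f + j)))" by simp
      also have "\<dots> \<le> (real m / real N) ^ (f + j) *
          exp (- (real (m - (f + j)) * real ((f + b) - (f + j)) / real N)) * real (N choose m)"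
        using True jb bN E by (intro binomial_diff_le_exp) (auto simp: N_def)
      also have "\<dots> \<le> (p ^ f * p ^ j) * exp (2 * real k + real f - real b * p) * c"
      proof -
        \<comment> \<open>Going from (m - f - j) (b - j) / N to b p loses at most f + j from the
          prescribed edges, as b \<le> N, and at most j from the trace, as m \<le> N. With j \<le> k
          this is the origin of exp (2 k + f).\<close>
        have "real b * p - (real f + real j) - real j \<le> real (m - (f + j)) * real (b - j) / real N"
        proof (cases "N = 0")
          case True
          then show ?thesis using E by (simp add: p_def N_def)
        next
          case False
          have bf: "(real f + real j) * real b \<le> (real f + real j) * real N"
            using bN by (intro mult_left_mono) auto
          have bj: "real m * real j \<le> real N * real j"
            using E by (intro mult_right_mono) (auto simp: N_def)
          have "(real b * p - (real f + real j) - real j) * real N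
            = real b * real m - (real f + real j) * real N - real N * real j"
            using False by (simp add: p_def N_def field_simps)
          also have "\<dots> \<le> real b * real m - (real f + real j) * real b - real m * real j"
            using bf bj by linarith
          also have "\<dots> \<le> (real m - (real f + real j)) * (real b - real j)"
            by (simp add: algebra_simps)
          also have "\<dots> = real (m - (f + j)) * real (b - j)"
            using True jb by (simp add: of_nat_diff)
          finally show ?thesis using False by (simp add: pos_le_divide_eq)
        qed
        then have "exp (- (real (m - (f + j)) * real (b - j) / real N)) \<le> exp (2 * real k + real f - real b * p)"
          using J by (simp add: j_def)
        then show ?thesis
          using cpos p by (auto simp: c_def p_def N_def power_add intro!: mult_right_mono mult_left_mono)
      qed
      also have "\<dots> = p ^ card J * u * c"
        by (simp add: u_def j_def exp_diff exp_minus field_simps)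
      finally show ?thesis .
    qed
  qed
  have sub: "nsets E m \<inter> ?Q \<subseteq> (\<Union>i\<le>k. \<Union>J\<in>nsets B i. W J)"
  proof
    fix G assume G: "G \<in> nsets E m \<inter> ?Q"
    then have "G \<inter> B \<in> nsets B (card (G \<inter> B))" "G \<in> W (G \<inter> B)"
      using finFB by (auto simp: nsets_def W_def)
    then show "G \<in> (\<Union>i\<le>k. \<Union>J\<in>nsets B i. W J)" using G by blast
  qed
  have finW: "finite (W J)" for J using fin by (simp add: W_def)
  have u0: "u \<ge> 0" using p by (simp add: u_def)
  have "real (card (nsets E m \<inter> ?Q)) \<le> real (card (\<Union>i\<le>k. \<Union>J\<in>nsets B i. W J))"
    using sub finW finFB by (intro of_nat_mono card_mono) (auto simp: finite_imp_finite_nsets)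
  also have "\<dots> \<le> real (\<Sum>i\<le>k. card (\<Union>J\<in>nsets B i. W J))"
    by (intro of_nat_mono card_UN_le) auto
  also have "\<dots> \<le> real (\<Sum>i\<le>k. \<Sum>J\<in>nsets B i. card (W J))"
    using finFB by (intro of_nat_mono sum_mono card_UN_le) (auto simp: finite_imp_finite_nsets)
  also have "\<dots> = (\<Sum>i\<le>k. \<Sum>J\<in>nsets B i. real (card (W J)))" by simp
  also have "\<dots> \<le> (\<Sum>i\<le>k. \<Sum>J\<in>nsets B i. p ^ i * u * c)"
  proof (intro sum_mono)
    fix i J assume "i \<in> {..k}" "J \<in> nsets B i"
    then show "real (card (W J)) \<le> p ^ i * u * c" using W[of J] by (auto simp: nsets_def)
  qed
  also have "\<dots> = (\<Sum>i\<le>k. real (b choose i) * p ^ i * u * c)" using finFB by (simp add: b_def mult_ac)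
  \<comment> \<open>Adding 1 to the mean b p makes the base at least 1, so that the exponent i can
    be raised to k also when b p is small.\<close>
  also have "\<dots> \<le> (\<Sum>i\<le>k. (1 + real b * p) ^ k * u * c)"
  proof (intro sum_mono mult_right_mono)
    fix i assume i: "i \<in> {..k}"
    have "b choose i \<le> b ^ i"
      by (cases "i \<le> b") (auto simp: binomial_le_pow binomial_eq_0)
    then have "real (b choose i) \<le> real b ^ i" by (metis of_nat_le_iff of_nat_power)
    then have "real (b choose i) * p ^ i \<le> real b ^ i * p ^ i" using p by (intro mult_right_mono) auto
    also have "\<dots> = (real b * p) ^ i" by (simp add: power_mult_distrib)
    also have "\<dots> \<le> (1 + real b * p) ^ i" using p by (intro power_mono) auto
    also have "\<dots> \<le> (1 + real b * p) ^ k" using p i by (intro power_increasing) auto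
    finally show "real (b choose i) * p ^ i \<le> (1 + real b * p) ^ k" .
  qed (use u0 cpos in auto)
  also have "\<dots> = (real k + 1) * (1 + real b * p) ^ k * u * c" by (simp add: algebra_simps)
  finally have *: "real (card (nsets E m \<inter> ?Q)) \<le> (real k + 1) * (1 + real b * p) ^ k * u * c" .
  have "measure_pmf.prob (pmf_of_set (nsets E m)) ?Q = real (card (nsets E m \<inter> ?Q)) / c"
    using fin ne E by (simp add: measure_pmf_of_set c_def N_def)
  also have "\<dots> \<le> (real k + 1) * (1 + real b * p) ^ k * u"
    using * cpos by (simp add: divide_le_eq)
  finally show ?thesis by (simp add: u_def b_def f_def mult.assoc)
qed

subsection \<open>Marginals and increments of the graph process\<close>

lemma length_graph_process: "Gs \<in> set_pmf (graph_process n k) \<Longrightarrow> length Gs = Suc k"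
  by (induction k arbitrary: Gs) auto

text \<open>A step only appends to the history, so truncating a long run gives the law of a short
  one. This reduces an event about early graphs to the process stopped there.\<close>

lemma take_graph_process:
  assumes "m \<le> k"
  shows "map_pmf (take (Suc m)) (graph_process n k) = graph_process n m"
  using assms
proof (induction rule: dec_induct)
  case base
  have "map_pmf (take (Suc m)) (graph_process n m) = map_pmf id (graph_process n m)"
    by (rule map_pmf_cong) (auto simp: length_graph_process)
  then show ?case by (simp add: pmf.map_id)
next
  case (step i)
  have "map_pmf (take (Suc m)) (graph_process n (Suc i)) =
      bind_pmf (graph_process n i) (\<lambda>Gs. return_pmf (take (Suc m) Gs))"
    unfolding graph_process.simps map_bind_pmf pmf.map_comp o_def
  proof (rule bind_pmf_cong)
    fix Gs assume "Gs \<in> set_pmf (graph_process n i)"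
    then have "take (Suc m) (Gs @ [G]) = take (Suc m) Gs" for G :: "nat set set"
      using length_graph_process[of Gs n i] step by simp
    then show "map_pmf (\<lambda>e. take (Suc m) (Gs @ [insert e (last Gs)])) (pmf_of_set (nsets {..<n} 2 - last Gs))
       = return_pmf (take (Suc m) Gs)" by simp
  qed simp
  also have "\<dots> = map_pmf (take (Suc m)) (graph_process n i)" by (simp add: map_pmf_def)
  finally show ?case using step by simp
qed

text \<open>Each set \<open>X\<close> of size m + 1 has exactly m + 1 predecessors, one for every
  element that may have come last, and each of them leads to \<open>X\<close> with probability 1 /
  (card E - m). The resulting mass does not depend on \<open>X\<close>.\<close>

lemma map_insert_pmf_of_nsets:
  assumes "finite E" "m < card E"
  shows "bind_pmf (pmf_of_set (nsets E m)) (\<lambda>G. map_pmf (\<lambda>e. insert e G) (pmf_of_set (E - G)))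
    = pmf_of_set (nsets E (Suc m))"
proof (rule pmf_eqI)
  fix X
  have fin: "finite (nsets E k)" for k using assms by (simp add: finite_imp_finite_nsets)
  have ne: "nsets E k \<noteq> {}" if "k \<le> card E" for k
    using that by (metis card_nsets card.empty binomial_eq_0_iff not_less)
  have 1: "pmf (map_pmf (\<lambda>e. insert e G) (pmf_of_set (E - G))) X
      = (if X \<in> nsets E (Suc m) \<and> G \<subseteq> X then 1 / real (card E - m) else 0)" if "G \<in> nsets E m" for G
  proof -
    have G: "G \<subseteq> E" "finite G" "card G = m" using that by (auto simp: nsets_def)
    have ne: "E - G \<noteq> {}" using G assms by (metis Diff_eq_empty_iff card_mono not_less)
    have "pmf (map_pmf (\<lambda>e. insert e G) (pmf_of_set (E - G))) X
       = real (card ((E - G) \<inter> ((\<lambda>e. insert e G) -` {X}))) / real (card (E - G))"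
      using ne assms by (simp add: pmf_map measure_pmf_of_set)
    also have "card (E - G) = card E - m" using G by (simp add: card_Diff_subset)
    also have "card ((E - G) \<inter> ((\<lambda>e. insert e G) -` {X})) = (if X \<in> nsets E (Suc m) \<and> G \<subseteq> X then 1 else 0)"
    proof (cases "X \<in> nsets E (Suc m) \<and> G \<subseteq> X")
      case True
      then have "card (X - G) = 1" using G by (auto simp: nsets_def card_Diff_subset)
      then obtain e where e: "X - G = {e}" by (auto simp: card_1_singleton_iff)
      then have "(E - G) \<inter> ((\<lambda>e. insert e G) -` {X}) = {e}" using True by (auto simp: nsets_def)
      then show ?thesis using True by simp
    next
      case False
      then have "(E - G) \<inter> ((\<lambda>e. insert e G) -` {X}) = {}" using G by (auto simp: nsets_def)
      then show ?thesis using False by simp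
    qed
    finally show ?thesis by simp
  qed
  have "pmf (bind_pmf (pmf_of_set (nsets E m)) (\<lambda>G. map_pmf (\<lambda>e. insert e G) (pmf_of_set (E - G)))) X
    = (\<Sum>G\<in>nsets E m. if X \<in> nsets E (Suc m) \<and> G \<subseteq> X then 1 / real (card E - m) else 0) / real (card E choose m)"
    using fin[of m] ne[of m] assms by (simp add: pmf_bind_pmf_of_set 1)
  also have "\<dots> = indicator (nsets E (Suc m)) X / real (card E choose Suc m)"
  proof (cases "X \<in> nsets E (Suc m)")
    case True
    have "(\<Sum>G\<in>nsets E m. if X \<in> nsets E (Suc m) \<and> G \<subseteq> X then 1 / real (card E - m) else 0)
        = (\<Sum>G\<in>{G \<in> nsets E m. G \<subseteq> X}. 1 / real (card E - m))"
      using True fin by (simp add: sum.inter_filter del: sum_constant)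
    also have "{G \<in> nsets E m. G \<subseteq> X} = nsets X m" using True by (auto simp: nsets_def)
    also have "(\<Sum>G\<in>nsets X m. 1 / real (card E - m)) = real (Suc m) / real (card E - m)"
      using True by (simp add: nsets_def[of E])
    also have "\<dots> / real (card E choose m) = 1 / real (card E choose Suc m)"
    proof -
      have "Suc m * (card E choose Suc m) = (card E - m) * (card E choose m)"
        by (metis binomial_absorb_comp binomial_absorption)
      then have "real (Suc m) * real (card E choose Suc m) = real (card E - m) * real (card E choose m)"
        by (metis of_nat_mult)
      moreover have "real (card E choose Suc m) > 0" "real (card E - m) > 0" "real (card E choose m) > 0"
        using assms by auto
      ultimately show ?thesis by (simp add: field_simps del: binomial_Suc_Suc)
    qed
    finally show ?thesis using True by simp
  qed simp
  also have "\<dots> = pmf (pmf_of_set (nsets E (Suc m))) X"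
    using fin ne[of "Suc m"] assms by simp
  finally show "pmf (bind_pmf (pmf_of_set (nsets E m)) (\<lambda>G. map_pmf (\<lambda>e. insert e G) (pmf_of_set (E - G)))) X
     = pmf (pmf_of_set (nsets E (Suc m))) X" .
qed

lemma last_graph_process:
  assumes "m \<le> n choose 2"
  shows "map_pmf last (graph_process n m) = pmf_of_set (nsets (nsets {..<n} 2) m)"
  using assms
proof (induction m)
  case 0
  have "nsets (nsets {..<n} 2) 0 = {{}}" by (auto simp: nsets_def)
  then show ?case by (simp add: pmf_of_set_singleton)
next
  case (Suc m)
  let ?E = "nsets {..<n} 2"
  have "map_pmf last (graph_process n (Suc m))
    = bind_pmf (map_pmf last (graph_process n m)) (\<lambda>G. map_pmf (\<lambda>e. insert e G) (pmf_of_set (?E - G)))"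
    by (simp add: map_bind_pmf bind_map_pmf pmf.map_comp o_def)
  also have "\<dots> = pmf_of_set (nsets ?E (Suc m))"
    using Suc by (simp add: map_insert_pmf_of_nsets finite_imp_finite_nsets)
  finally show ?case .
qed

lemma prob_graph_process_nth:
  assumes "m \<le> k" "m \<le> n choose 2"
  shows "measure_pmf.prob (graph_process n k) {Gs. Q (Gs ! m)}
    = measure_pmf.prob (pmf_of_set (nsets (nsets {..<n} 2) m)) {G. Q G}"
proof -
  have "measure_pmf.prob (graph_process n k) {Gs. Q (Gs ! m)}
      = measure_pmf.prob (graph_process n k) (take (Suc m) -` {Gs. Q (Gs ! m)})"
    by (simp add: vimage_def)
  also have "\<dots> = measure_pmf.prob (graph_process n m) {Gs. Q (Gs ! m)}"
    using take_graph_process[OF assms(1), of n] by (metis measure_map_pmf)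
  also have "\<dots> = measure_pmf.prob (graph_process n m) (last -` {G. Q G})"
  proof -
    have "last Gs = Gs ! m" if "Gs \<in> set_pmf (graph_process n m)" for Gs
      using length_graph_process[OF that] by (cases "Gs = []") (auto simp: last_conv_nth)
    then have "{Gs. Q (Gs ! m)} \<inter> set_pmf (graph_process n m) = last -` {G. Q G} \<inter> set_pmf (graph_process n m)"
      by auto
    then show ?thesis by (metis measure_Int_set_pmf)
  qed
  also have "\<dots> = measure_pmf.prob (pmf_of_set (nsets (nsets {..<n} 2) m)) {G. Q G}"
    using last_graph_process[OF assms(2)] by (metis measure_map_pmf)
  finally show ?thesis .
qed

lemma take_in_set_graph_process:
  assumes "Gs \<in> set_pmf (graph_process n k)" "m \<le> k"
  shows "take (Suc m) Gs \<in> set_pmf (graph_process n m)"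
  using assms(1) take_graph_process[OF assms(2), of n, symmetric] by auto

lemma graph_process_nth:
  assumes "Gs \<in> set_pmf (graph_process n k)" "m \<le> k" "m \<le> n choose 2"
  shows "Gs ! m \<in> nsets (nsets {..<n} 2) m"
proof -
  let ?E = "nsets {..<n} 2"
  have ne: "nsets ?E m \<noteq> {}" "finite (nsets ?E m)"
    using assms by (auto simp: finite_imp_finite_nsets)
      (metis card_nsets card.empty binomial_eq_0_iff not_less card_lessThan)
  have len: "length Gs = Suc k" using assms length_graph_process by blast
  have "last (take (Suc m) Gs) = Gs ! m" using len assms by (simp add: take_Suc_conv_app_nth)
  moreover have "last (take (Suc m) Gs) \<in> set_pmf (map_pmf last (graph_process n m))"
    using take_in_set_graph_process[OF assms(1,2)] by auto
  ultimately show ?thesis using last_graph_process[OF assms(3)] ne by simp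
qed

lemma graph_process_nth_Suc:
  assumes "Gs \<in> set_pmf (graph_process n k)" "m < k" "k \<le> n choose 2"
  shows "\<exists>e. Gs ! Suc m = insert e (Gs ! m)"
proof -
  have len: "length Gs = Suc k" using assms length_graph_process by blast
  have "take (Suc (Suc m)) Gs \<in> set_pmf (graph_process n (Suc m))"
    using take_in_set_graph_process[OF assms(1), of "Suc m"] assms by simp
  then obtain Hs e where Hs: "Hs \<in> set_pmf (graph_process n m)"
    and eq: "take (Suc (Suc m)) Gs = Hs @ [insert e (last Hs)]" by auto
  have lH: "length Hs = Suc m" using Hs length_graph_process by blast
  have "Gs ! Suc m = take (Suc (Suc m)) Gs ! Suc m" by simp
  also have "\<dots> = insert e (last Hs)" unfolding eq using lH by (simp add: nth_append)
  also have "last Hs = Hs ! m" using lH by (cases "Hs = []") (auto simp: last_conv_nth)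
  also have "\<dots> = (Hs @ [insert e (last Hs)]) ! m" using lH by (simp add: nth_append)
  also have "\<dots> = Gs ! m" unfolding eq[symmetric] by simp
  finally show ?thesis by blast
qed

text \<open>Given the history up to time m, the next edge is uniform among the (n choose 2) - m
  missing ones, and \<open>Q\<close> is decided by that history. The set difference forces the new
  edge to be \<open>e\<close> itself.\<close>

lemma prob_graph_process_new_edge:
  assumes "m < k" "k \<le> n choose 2"
  shows "measure_pmf.prob (graph_process n k) {Gs. Q (Gs ! m) \<and> e \<in> Gs ! Suc m - Gs ! m}
    \<le> measure_pmf.prob (pmf_of_set (nsets (nsets {..<n} 2) m)) {G. Q G} / real ((n choose 2) - m)"
proof -
  let ?E = "nsets {..<n} 2"
  let ?A = "{Gs. Q (Gs ! m) \<and> e \<in> Gs ! Suc m - Gs ! m}"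
  let ?r = "1 / real ((n choose 2) - m)"
  \<comment> \<open>The event depends on the first m + 2 graphs only, so it may be measured in the
    process stopped at m + 1.\<close>
  have "take (Suc (Suc m)) -` ?A = ?A" by auto
  then have 1: "measure_pmf.prob (graph_process n k) ?A = measure_pmf.prob (graph_process n (Suc m)) ?A"
    using measure_map_pmf[of "take (Suc (Suc m))" "graph_process n k" ?A]
    by (simp only: take_graph_process[OF Suc_leI[OF assms(1)]])
  have "emeasure (measure_pmf (graph_process n (Suc m))) ?A
     = (\<integral>\<^sup>+ Gs. emeasure (measure_pmf (map_pmf (\<lambda>e. Gs @ [insert e (last Gs)]) (pmf_of_set (?E - last Gs)))) ?A
          \<partial>measure_pmf (graph_process n m))" by simp
  also have "\<dots> \<le> (\<integral>\<^sup>+ Gs. ennreal ?r * indicator {Gs. Q (Gs ! m)} Gs \<partial>measure_pmf (graph_process n m))"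
  proof (rule nn_integral_mono_AE, rule AE_pmfI)
    fix Gs assume Gs: "Gs \<in> set_pmf (graph_process n m)"
    have len: "length Gs = Suc m" using Gs length_graph_process by blast
    have la: "last Gs = Gs ! m" using len by (cases "Gs = []") (auto simp: last_conv_nth)
    have G: "Gs ! m \<in> nsets ?E m" using graph_process_nth[OF Gs] assms by simp
    then have cd: "card (?E - Gs ! m) = (n choose 2) - m"
      by (auto simp: nsets_def[of ?E] card_Diff_subset)
    then have ne: "?E - Gs ! m \<noteq> {}" 
    proof -
      have "card (?E - Gs ! m) > 0" unfolding cd using assms by simp
      then show ?thesis by (metis card.empty less_numeral_extra(3))
    qed
    let ?M = "map_pmf (\<lambda>e. Gs @ [insert e (last Gs)]) (pmf_of_set (?E - last Gs))"
    have "measure_pmf.prob ?M ?A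
      = measure_pmf.prob (pmf_of_set (?E - Gs ! m)) {x. Q (Gs ! m) \<and> e \<in> insert x (Gs ! m) - Gs ! m}"
    proof -
      have "(\<lambda>e. Gs @ [insert e (Gs ! m)]) -` ?A = {x. Q (Gs ! m) \<and> e \<in> insert x (Gs ! m) - Gs ! m}"
        using len by (auto simp: nth_append)
      then show ?thesis unfolding measure_map_pmf la by simp
    qed
    also have "\<dots> = real (card ((?E - Gs ! m) \<inter> {x. Q (Gs ! m) \<and> e \<in> insert x (Gs ! m) - Gs ! m}))
         / real ((n choose 2) - m)"
      using ne cd by (subst measure_pmf_of_set) (auto simp: finite_imp_finite_nsets)
    also have "\<dots> \<le> ?r * indicator {Gs. Q (Gs ! m)} Gs"
    proof (cases "Q (Gs ! m)")
      case True
      have "card ((?E - Gs ! m) \<inter> {x. Q (Gs ! m) \<and> e \<in> insert x (Gs ! m) - Gs ! m}) \<le> card {e}"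
        by (rule card_mono) auto
      then have "real (card ((?E - Gs ! m) \<inter> {x. Q (Gs ! m) \<and> e \<in> insert x (Gs ! m) - Gs ! m})) \<le> 1" by simp
      then have "real (card ((?E - Gs ! m) \<inter> {x. Q (Gs ! m) \<and> e \<in> insert x (Gs ! m) - Gs ! m}))
         / real ((n choose 2) - m) \<le> ?r" by (rule divide_right_mono) simp
      then show ?thesis using True by simp
    next
      case False
      then have "(?E - Gs ! m) \<inter> {x. Q (Gs ! m) \<and> e \<in> insert x (Gs ! m) - Gs ! m} = {}" by simp
      then show ?thesis using False by simp
    qed
    finally have "measure_pmf.prob ?M ?A \<le> ?r * indicator {Gs. Q (Gs ! m)} Gs" .
    then have "ennreal (measure_pmf.prob ?M ?A) \<le> ennreal (?r * indicator {Gs. Q (Gs ! m)} Gs)"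
      by (rule ennreal_leI)
    then show "emeasure (measure_pmf ?M) ?A \<le> ennreal ?r * indicator {Gs. Q (Gs ! m)} Gs"
      unfolding measure_pmf.emeasure_eq_measure by (cases "Q (Gs ! m)") simp_all
  qed
  also have "\<dots> = ennreal ?r * emeasure (measure_pmf (graph_process n m)) {Gs. Q (Gs ! m)}"
    by (subst nn_integral_cmult_indicator) auto
  also have "\<dots> = ennreal (?r * measure_pmf.prob (graph_process n m) {Gs. Q (Gs ! m)})"
    unfolding measure_pmf.emeasure_eq_measure by (rule ennreal_mult[symmetric]) auto
  finally have "measure_pmf.prob (graph_process n (Suc m)) ?A
     \<le> ?r * measure_pmf.prob (graph_process n m) {Gs. Q (Gs ! m)}"
    by (subst (asm) measure_pmf.emeasure_eq_measure) (simp add: ennreal_le_iff)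
  then show ?thesis using 1 prob_graph_process_nth[of m m n Q] assms by simp
qed

subsection \<open>Cuts left by the adversary\<close>

text \<open>For two-element edges this is the edge cut of \<open>S\<close>. Being a filter on
  \<open>E\<close>, it commutes with passing to subgraphs, so the boundary in a random graph is the
  trace of one fixed set of pairs.\<close>

definition boundary :: "'a set set \<Rightarrow> 'a set \<Rightarrow> 'a set set" where
  "boundary E S = {e \<in> E. e \<inter> S \<noteq> {} \<and> \<not> e \<subseteq> S}"

lemma boundary_mono: "E \<subseteq> F \<Longrightarrow> boundary E S \<subseteq> boundary F S"
  by (auto simp: boundary_def)

lemma boundary_eq_Int: "G \<subseteq> E \<Longrightarrow> boundary G S = G \<inter> boundary E S"
  by (auto simp: boundary_def)

lemma induced_edges_eq_Int: "G \<subseteq> E \<Longrightarrow> induced_edges G S = G \<inter> induced_edges E S"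
  by (auto simp: induced_edges_def)

lemma induced_boundary_disjoint: "induced_edges E S \<inter> boundary E S = {}"
  by (auto simp: boundary_def induced_edges_def)

lemma induced_edges_nsets: "S \<subseteq> V \<Longrightarrow> induced_edges (nsets V 2) S = nsets S 2"
  by (auto simp: induced_edges_def nsets_def)

lemma card_boundary_nsets:
  assumes "finite V" "S \<subseteq> V"
  shows "card (boundary (nsets V 2) S) = card S * (card V - card S)"
proof -
  have finS: "finite S" using assms finite_subset by auto
  have "boundary (nsets V 2) S = (\<lambda>(u, v). {u, v}) ` (S \<times> (V - S))"
  proof (intro equalityI subsetI)
    fix e assume "e \<in> boundary (nsets V 2) S"
    then obtain x y where xy: "e = {x, y}" "x \<in> V" "y \<in> V" "x \<noteq> y" "e \<inter> S \<noteq> {}" "\<not> e \<subseteq> S"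
      by (auto simp: boundary_def nsets_2_eq)
    then consider "x \<in> S" "y \<notin> S" | "y \<in> S" "x \<notin> S" by auto
    then show "e \<in> (\<lambda>(u, v). {u, v}) ` (S \<times> (V - S))"
    proof cases
      case 1
      then show ?thesis using xy by (intro image_eqI[of _ _ "(x, y)"]) auto
    next
      case 2
      then show ?thesis using xy by (intro image_eqI[of _ _ "(y, x)"]) auto
    qed
  qed (use assms in \<open>auto simp: boundary_def\<close>)
  moreover have "inj_on (\<lambda>(u, v). {u, v}) (S \<times> (V - S))"
    by (auto simp: inj_on_def doubleton_eq_iff)
  ultimately show ?thesis
    using assms finS by (simp add: card_image card_cartesian_product card_Diff_subset)
qed

section \<open>Reachability, and edge counts around a vertex set\<close>

lemma rtrancl_adj_mem:
  assumes "(a, w) \<in> (adj F)\<^sup>*" "a \<in> C" "F \<subseteq> nsets C 2"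
  shows "w \<in> C"
  using assms(1,2) by (induction rule: rtrancl_induct) (use assms(3) in \<open>auto simp: adj_def\<close>)

lemma sym_rtrancl_adj: "(u, v) \<in> (adj F)\<^sup>* \<Longrightarrow> (v, u) \<in> (adj F)\<^sup>*"
proof -
  have "sym (adj F)" by (auto simp: sym_def adj_def insert_commute)
  then show "(u, v) \<in> (adj F)\<^sup>* \<Longrightarrow> (v, u) \<in> (adj F)\<^sup>*" using sym_rtrancl symD by fastforce
qed

text \<open>Each vertex other than the root is charged to the edge that leads to a vertex closer to the root.\<close>

lemma card_reachable_le:
  assumes "finite C" "a \<in> C" "F \<subseteq> nsets C 2"
  defines "S \<equiv> {w. (a, w) \<in> (adj F)\<^sup>*}"
  shows "card S \<le> card (induced_edges F S) + 1"
proof -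
  define d where "d w = (LEAST k. (a, w) \<in> adj F ^^ k)" for w
  have SC: "S \<subseteq> C" using rtrancl_adj_mem assms by (auto simp: S_def)
  have finS: "finite S" using SC assms finite_subset by auto
  have "\<exists>p. p \<in> S \<and> d p < d w \<and> {p, w} \<in> F" if w: "w \<in> S - {a}" for w
  proof -
    have "\<exists>k. (a, w) \<in> adj F ^^ k" using w by (auto simp: S_def rtrancl_power)
    then have dw: "(a, w) \<in> adj F ^^ d w" unfolding d_def by (rule LeastI_ex)
    have "d w \<noteq> 0"
    proof
      assume "d w = 0"
      then show False using dw w by simp
    qed
    then obtain k where k: "d w = Suc k" by (cases "d w") auto
    then obtain p where p: "(a, p) \<in> adj F ^^ k" "(p, w) \<in> adj F" using dw by auto
    then have "d p \<le> k" unfolding d_def by (intro Least_le)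
    moreover have "p \<in> S" using p by (auto simp: S_def rtrancl_power)
    ultimately show ?thesis using p k by (auto simp: adj_def)
  qed
  then obtain p where p: "\<And>w. w \<in> S - {a} \<Longrightarrow> p w \<in> S \<and> d (p w) < d w \<and> {p w, w} \<in> F"
    by metis
  have "inj_on (\<lambda>w. {p w, w}) (S - {a})"
  proof (rule inj_onI)
    fix x y assume xy: "x \<in> S - {a}" "y \<in> S - {a}" "{p x, x} = {p y, y}"
    then consider "x = y" | "p x = y" "p y = x" by (auto simp: doubleton_eq_iff)
    then show "x = y"
      using p[OF xy(1)] p[OF xy(2)] by cases auto
  qed
  moreover have "(\<lambda>w. {p w, w}) ` (S - {a}) \<subseteq> induced_edges F S"
    using p by (auto simp: induced_edges_def)
  moreover have "finite (induced_edges F S)"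
    using assms finite_subset[OF assms(3)] by (auto simp: induced_edges_def finite_imp_finite_nsets)
  ultimately have "card (S - {a}) \<le> card (induced_edges F S)" by (intro card_inj_on_le)
  moreover have "a \<in> S" by (simp add: S_def)
  ultimately show ?thesis using finS by simp
qed

lemma sum_degree_in:
  assumes "finite E" "finite S"
  shows "(\<Sum>v\<in>S. degree_in E v) = (\<Sum>e\<in>E. card (e \<inter> S))"
proof -
  have "(\<Sum>v\<in>S. degree_in E v) = (\<Sum>v\<in>S. \<Sum>e\<in>E. if v \<in> e then 1 else 0)"
    using assms by (simp add: degree_in_def sum.inter_filter[symmetric])
  also have "\<dots> = (\<Sum>e\<in>E. \<Sum>v\<in>S. if v \<in> e then 1 else 0)" by (rule sum.swap)
  also have "\<dots> = (\<Sum>e\<in>E. card (e \<inter> S))"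
    using assms by (simp add: sum.inter_filter[symmetric] Int_def conj_commute)
  finally show ?thesis .
qed

lemma sum_degree_in_le:
  assumes "finite V" "E \<subseteq> nsets V 2" "S \<subseteq> V"
  shows "(\<Sum>v\<in>S. degree_in E v) \<le> 2 * card (induced_edges E S) + card (boundary E S)"
proof -
  have fin: "finite E" "finite S" using assms finite_imp_finite_nsets finite_subset by metis+
  have "(\<Sum>v\<in>S. degree_in E v) = (\<Sum>e\<in>E. card (e \<inter> S))" by (rule sum_degree_in[OF fin])
  also have "\<dots> \<le> (\<Sum>e\<in>E. (if e \<in> induced_edges E S then 2 else 0) + (if e \<in> boundary E S then 1 else 0))"
  proof (rule sum_mono)
    fix e assume e: "e \<in> E"
    then have e2: "card e = 2" "finite e" using assms by (auto simp: nsets_def)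
    consider "e \<subseteq> S" | "e \<inter> S = {}" | "e \<inter> S \<noteq> {}" "\<not> e \<subseteq> S" by blast
    then show "card (e \<inter> S) \<le> (if e \<in> induced_edges E S then 2 else 0) + (if e \<in> boundary E S then 1 else 0)"
    proof cases
      case 1
      then show ?thesis using e e2 by (simp add: induced_edges_def Int_absorb2)
    next
      case 3
      then have "card (e \<inter> S) < card e" using e2 by (intro psubset_card_mono) auto
      then show ?thesis using 3 e e2 by (simp add: boundary_def)
    qed simp
  qed
  also have "\<dots> = 2 * card (induced_edges E S) + card (boundary E S)"
    using fin by (simp add: sum.distrib sum.inter_filter[symmetric] induced_edges_def boundary_def)
  finally show ?thesis .
qed

lemma card_boundary_le_sum_degree_in:
  assumes "finite H" "finite S" "boundary E S \<subseteq> H"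
  shows "card (boundary E S) \<le> (\<Sum>v\<in>S. degree_in H v)"
proof -
  have "card (boundary E S) = (\<Sum>e\<in>boundary E S. 1)" by simp
  also have "\<dots> \<le> (\<Sum>e\<in>boundary E S. card (e \<inter> S))"
  proof (rule sum_mono)
    fix e assume "e \<in> boundary E S"
    then have "card (e \<inter> S) > 0" using assms by (auto simp: boundary_def card_gt_0_iff)
    then show "1 \<le> card (e \<inter> S)" by simp
  qed
  also have "\<dots> \<le> (\<Sum>e\<in>H. card (e \<inter> S))" using assms by (intro sum_mono2) auto
  also have "\<dots> = (\<Sum>v\<in>S. degree_in H v)" using sum_degree_in[OF assms(1,2)] by simp
  finally show ?thesis .
qed

lemma component_boundary_empty:
  assumes "C \<in> components V G" "G \<subseteq> nsets V 2"
  shows "boundary G C = {}"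
proof (rule ccontr)
  obtain r where r: "C = {v \<in> V. (r, v) \<in> (adj G)\<^sup>*}" using assms by (auto simp: components_def)
  assume "boundary G C \<noteq> {}"
  then obtain e where e: "e \<in> G" "e \<inter> C \<noteq> {}" "\<not> e \<subseteq> C" by (auto simp: boundary_def)
  then obtain x where x: "x \<in> e" "x \<in> C" by auto
  obtain y where y: "y \<in> e" "y \<notin> C" using e by auto
  have "card e = 2" "e \<subseteq> V" using e assms by (auto simp: nsets_def)
  then have "e = {x, y}" using x y by (auto simp: card_2_iff)
  then have "(x, y) \<in> adj G" using e by (simp add: adj_def)
  then have "y \<in> C" using x y \<open>e \<subseteq> V\<close> by (auto simp: r intro: rtrancl.rtrancl_into_rtrancl)
  then show False using y by simp
qed

text \<open>A walk in \<open>G\<close> from \<open>S\<close> to the rest of \<open>C\<close> must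
  leave \<open>S\<close> along some edge. It supplies the deleted edge at which a vertex of
  \<open>S\<close> is forced to have two inner neighbours.\<close>

lemma component_subset_boundary_nonempty:
  assumes "C \<in> components V G" "S \<subseteq> C" "S \<noteq> {}" "S \<noteq> C"
  shows "boundary G S \<noteq> {}"
proof
  assume b: "boundary G S = {}"
  obtain r where r: "C = {v \<in> V. (r, v) \<in> (adj G)\<^sup>*}" using assms by (auto simp: components_def)
  obtain s t where s: "s \<in> S" and t: "t \<in> C" "t \<notin> S" using assms by auto
  have "(r, s) \<in> (adj G)\<^sup>*" "(r, t) \<in> (adj G)\<^sup>*" using s t assms(2) r by auto
  then have "(s, r) \<in> (adj G)\<^sup>*" "(r, t) \<in> (adj G)\<^sup>*" using sym_rtrancl_adj by metis+
  then have "(s, t) \<in> (adj G)\<^sup>*" by (rule rtrancl_trans)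
  then have "t \<in> S" using s
    by (induction rule: rtrancl_induct) (use b in \<open>auto simp: adj_def boundary_def\<close>)
  then show False using t by simp
qed

text \<open>\<open>S\<close> is the smaller of two components of \<open>G[C] - H\<close>, so that all its boundary edges belong
  to \<open>H\<close>. A vertex \<open>v\<close> of \<open>S\<close> on a boundary edge loses less than half of its edges, hence has
  at least two neighbours inside \<open>S\<close>.\<close>

lemma disconnected_imp_cut:
  fixes \<alpha> :: real
  assumes V: "finite V" "G \<subseteq> nsets V 2" and C: "C \<in> components V G"
    and H: "H \<subseteq> induced_edges G C"
      "\<And>v. v \<in> C \<Longrightarrow> real (degree_in H v) \<le> \<alpha> * real (degree_in (induced_edges G C) v)"
    and \<alpha>: "0 \<le> \<alpha>" "\<alpha> < 1 / 2"
    and disc: "\<not> connected_graph C (induced_edges G C - H)"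
  obtains S u v w where "S \<subseteq> V" "S \<noteq> {}" "2 * card S \<le> card V"
    "card S \<le> card (induced_edges G S) + 1"
    "(1 - \<alpha>) * real (card (boundary G S)) \<le> 2 * \<alpha> * real (card (induced_edges G S))"
    "{u, v, w} \<subseteq> S" "u \<noteq> v" "v \<noteq> w" "u \<noteq> w" "{u, v} \<in> G" "{v, w} \<in> G"
proof -
  define F where "F = induced_edges G C - H"
  define R where "R a = {w. (a, w) \<in> (adj F)\<^sup>*}" for a
  have CV: "C \<subseteq> V" "C \<noteq> {}" using C by (auto simp: components_def)
  have finC: "finite C" using CV V finite_subset by auto
  have finG: "finite G" using V finite_imp_finite_nsets finite_subset by metis
  have FC: "F \<subseteq> nsets C 2" using V by (auto simp: F_def induced_edges_def nsets_def)
  have RC: "R a \<subseteq> C" if "a \<in> C" for a using rtrancl_adj_mem[OF _ that FC] by (auto simp: R_def)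
  obtain a b where ab: "a \<in> C" "b \<in> C" "(a, b) \<notin> (adj F)\<^sup>*"
    using disc CV by (auto simp: connected_graph_def F_def)
  have disj: "R a \<inter> R b = {}"
  proof (rule ccontr)
    assume "R a \<inter> R b \<noteq> {}"
    then obtain x where "(a, x) \<in> (adj F)\<^sup>*" "(b, x) \<in> (adj F)\<^sup>*" by (auto simp: R_def)
    then show False using ab(3) sym_rtrancl_adj rtrancl_trans by metis
  qed
  have "card (R a) + card (R b) \<le> card C"
    using card_Un_disjoint[OF _ _ disj] RC ab finC card_mono[OF finC, of "R a \<union> R b"]
    by (metis Un_subset_iff finite_subset)
  then have "2 * card (R a) \<le> card C \<or> 2 * card (R b) \<le> card C" by linarith
  moreover have "R a \<noteq> C" "R b \<noteq> C"
  proof -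
    have "b \<notin> R a" "a \<notin> R b" using ab sym_rtrancl_adj[of b a F] by (auto simp: R_def)
    then show "R a \<noteq> C" "R b \<noteq> C" using ab by auto
  qed
  ultimately obtain r where r: "r \<in> C" "2 * card (R r) \<le> card C" "R r \<noteq> C" using ab by metis
  define S where "S = R r"
  have rS: "r \<in> S" by (simp add: S_def R_def)
  have SC: "S \<subseteq> C" using RC r by (simp add: S_def)
  have SV: "S \<subseteq> V" using SC CV by simp
  have finS: "finite S" using SC finC finite_subset by auto
  have bdH: "boundary G S \<subseteq> H"
  proof
    fix e assume e: "e \<in> boundary G S"
    then have eG: "e \<in> G" by (simp add: boundary_def)
    have eC: "e \<subseteq> C" using e SC component_boundary_empty[OF C V(2)] by (auto simp: boundary_def)
    obtain x y where xy: "x \<in> e" "x \<in> S" "y \<in> e" "y \<notin> S" using e by (auto simp: boundary_def)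
    then have "e = {x, y}" using eG V by (auto simp: nsets_def card_2_iff)
    show "e \<in> H"
    proof (rule ccontr)
      assume "e \<notin> H"
      then have "(x, y) \<in> adj F" using eG eC \<open>e = {x, y}\<close> by (auto simp: adj_def F_def induced_edges_def)
      then show False using xy by (auto simp: S_def R_def intro: rtrancl.rtrancl_into_rtrancl)
    qed
  qed
  have finH: "finite H" using finite_subset[OF H(1)] finG by (simp add: induced_edges_def)
  have ind_eq: "induced_edges (induced_edges G C) S = induced_edges G S"
    using SC by (auto simp: induced_edges_def)
  have bd_eq: "boundary (induced_edges G C) S \<subseteq> boundary G S" by (auto simp: induced_edges_def boundary_def)
  have "card S \<le> card (induced_edges F S) + 1"
    unfolding S_def R_def by (rule card_reachable_le[OF finC r(1) FC])
  moreover have "card (induced_edges F S) \<le> card (induced_edges G S)"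
    using finG by (intro card_mono) (auto simp: induced_edges_def F_def)
  ultimately have c1: "card S \<le> card (induced_edges G S) + 1" by linarith
  have c2: "2 * card S \<le> card V" using r(2) card_mono[OF V(1) CV(1)] by (simp add: S_def)
  \<comment> \<open>All boundary edges are deleted, so their number b is at most \<alpha> times the
    degree sum over \<open>S\<close>, which is at most 2 a + b with a inner edges. Moving \<alpha> b
    to the left gives the ratio of the cut.\<close>
  have "real (card (boundary G S)) \<le> (\<Sum>v\<in>S. real (degree_in H v))"
    using card_boundary_le_sum_degree_in[OF finH finS bdH] by (metis of_nat_le_iff of_nat_sum)
  also have "\<dots> \<le> (\<Sum>v\<in>S. \<alpha> * real (degree_in (induced_edges G C) v))"
    using H(2) SC by (intro sum_mono) auto
  also have "\<dots> = \<alpha> * real (\<Sum>v\<in>S. degree_in (induced_edges G C) v)"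
    by (simp add: sum_distrib_left)
  also have "\<dots> \<le> \<alpha> * real (2 * card (induced_edges G S) + card (boundary G S))"
  proof (intro mult_left_mono of_nat_mono)
    have "(\<Sum>v\<in>S. degree_in (induced_edges G C) v)
      \<le> 2 * card (induced_edges G S) + card (boundary (induced_edges G C) S)"
      using sum_degree_in_le[OF V(1) _ SV, of "induced_edges G C"] V ind_eq
      by (auto simp: induced_edges_def)
    also have "card (boundary (induced_edges G C) S) \<le> card (boundary G S)"
      using finG by (intro card_mono bd_eq) (auto simp: boundary_def)
    finally show "(\<Sum>v\<in>S. degree_in (induced_edges G C) v) \<le> 2 * card (induced_edges G S) + card (boundary G S)"
      by simp
  qed (use \<alpha> in simp)
  finally have c3: "(1 - \<alpha>) * real (card (boundary G S)) \<le> 2 * \<alpha> * real (card (induced_edges G S))"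
    by (simp add: algebra_simps)
  have "boundary G S \<noteq> {}"
    using component_subset_boundary_nonempty[OF C SC] rS r(3) by (auto simp: S_def)
  then obtain e v where ev: "e \<in> boundary G S" "v \<in> e" "v \<in> S" by (auto simp: boundary_def)
  define I where "I = {e \<in> induced_edges G S. v \<in> e}"
  define B where "B = {e \<in> boundary G S. v \<in> e}"
  have finIB: "finite I" "finite B" using finG by (auto simp: I_def B_def induced_edges_def boundary_def)
  have B1: "card B \<ge> 1" using ev finIB by (metis B_def One_nat_def Suc_leI card_gt_0_iff empty_iff mem_Collect_eq)
  have "real (card B) \<le> real (degree_in H v)"
    unfolding degree_in_def using bdH finH by (auto simp: B_def intro!: card_mono)
  also have "\<dots> \<le> \<alpha> * real (degree_in (induced_edges G C) v)" using H(2) ev SC by auto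
  also have "\<dots> \<le> \<alpha> * real (card (I \<union> B))"
  proof (intro mult_left_mono of_nat_mono)
    have "{e \<in> induced_edges G C. v \<in> e} \<subseteq> I \<union> B"
      using ev by (auto simp: I_def B_def induced_edges_def boundary_def)
    then show "degree_in (induced_edges G C) v \<le> card (I \<union> B)"
      unfolding degree_in_def using finIB by (intro card_mono) auto
  qed (use \<alpha> in simp)
  also have "\<dots> \<le> \<alpha> * (real (card I) + real (card B))"
    using card_Un_le[of I B] \<alpha> by (intro mult_left_mono) auto
  finally have BI: "(1 - \<alpha>) * real (card B) \<le> \<alpha> * real (card I)" by (simp add: algebra_simps)
  \<comment> \<open>The same inequality at the single vertex \<open>v\<close>: one deleted edge
    already forces 1 - \<alpha> \<le> \<alpha> * card I, and \<alpha> < 1 / 2 excludes card I \<le>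
    1. So \<open>v\<close> is the centre of a path inside \<open>S\<close>.\<close>
  have "1 - \<alpha> = (1 - \<alpha>) * 1" by simp
  also have "\<dots> \<le> (1 - \<alpha>) * real (card B)" using B1 \<alpha> by (intro mult_left_mono) auto
  also note BI
  finally have "1 - \<alpha> \<le> \<alpha> * real (card I)" .
  moreover have "\<alpha> * real (card I) \<le> \<alpha> * 1" if "card I \<le> 1" using that \<alpha> by (intro mult_left_mono) auto
  ultimately have "\<not> card I \<le> 1" using \<alpha> by linarith
  then obtain e1 e2 where e12: "e1 \<in> I" "e2 \<in> I" "e1 \<noteq> e2"
    using finIB card_le_Suc0_iff_eq[of I] by auto
  have *: "\<exists>u. u \<in> S \<and> u \<noteq> v \<and> e = {v, u} \<and> {v, u} \<in> G" if e: "e \<in> I" for e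
  proof -
    have 1: "card e = 2" "v \<in> e" "e \<subseteq> S" "e \<in> G" using e V by (auto simp: I_def induced_edges_def nsets_def)
    then obtain x y where xy: "e = {x, y}" "x \<noteq> y" by (auto simp: card_2_iff)
    then consider "v = x" | "v = y" using 1 by auto
    then show ?thesis
    proof cases
      case 1
      then show ?thesis using xy \<open>e \<subseteq> S\<close> \<open>e \<in> G\<close> by blast
    next
      case 2
      then have "e = {v, x}" using xy by blast
      then show ?thesis using 2 xy \<open>e \<subseteq> S\<close> \<open>e \<in> G\<close> by blast
    qed
  qed
  obtain u where u: "u \<in> S" "u \<noteq> v" "e1 = {v, u}" "{v, u} \<in> G" using *[OF e12(1)] by auto
  obtain w where w: "w \<in> S" "w \<noteq> v" "e2 = {v, w}" "{v, w} \<in> G" using *[OF e12(2)] by auto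
  have "u \<noteq> w" using u w e12 by auto
  moreover have "S \<noteq> {}" using rS by auto
  moreover have "{u, v, w} \<subseteq> S" using u w ev by simp
  moreover have "{u, v} \<in> G" using u(4) by (simp add: insert_commute)
  ultimately show ?thesis using that[of S u v w] SV c1 c2 c3 u(2) w(2,4) by simp
qed

subsection \<open>Probabilities of sparse cuts\<close>

text \<open>Facts such as \<open>G \<subseteq> E\<close> or the nesting of a run hold only on the
  support, so plain monotonicity of the measure would not justify the event inclusions
  below.\<close>

lemma prob_le_on_support:
  assumes "\<And>x. x \<in> set_pmf M \<Longrightarrow> x \<in> A \<Longrightarrow> x \<in> B"
  shows "measure_pmf.prob M A \<le> measure_pmf.prob M B"
proof -
  have "measure_pmf.prob M A = measure_pmf.prob M (A \<inter> set_pmf M)" by (simp add: measure_Int_set_pmf)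
  also have "\<dots> \<le> measure_pmf.prob M B" using assms by (intro measure_pmf.finite_measure_mono) auto
  finally show ?thesis .
qed

lemma real_choose_two: "real (s choose 2) = real s * (real s - 1) / 2"
proof (induction s)
  case (Suc s)
  have "Suc s choose 2 = s + (s choose 2)" by (simp add: numeral_2_eq_2)
  then have "real (Suc s choose 2) = real s + real (s choose 2)" by simp
  then show ?case unfolding Suc by (simp add: field_simps)
qed simp

text \<open>For s = card S \<le> n / 2 there are at least s^2 boundary pairs but at most s^2 / 2
  inner pairs, so a boundary of at most 2 c times the inner edges, with c < 1, is a deviation of the
  order of the mean. The exponent of order p s^2 beats 2 ^ n once s is linear in n and n p tends to
  infinity.\<close>

lemma prob_cut_large:
  fixes c :: real and n m :: nat
  defines "E \<equiv> nsets {..<n} 2"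
  assumes m: "m \<le> n choose 2" and c: "0 \<le> c" "c < 1" and S: "S \<subseteq> {..<n}" "2 * card S \<le> n"
  shows "measure_pmf.prob (pmf_of_set (nsets E m))
      {G. real (card (boundary G S)) \<le> 2 * c * real (card (induced_edges G S))}
    \<le> (real (n choose 2) + 1) * exp (- (2 / 25 * (1 - c)\<^sup>2 * (real m / real (n choose 2)) * real (card S) ^ 2))"
proof -
  \<comment> \<open>Per unit of p s^2 the exponent will be at most 3 l^2 - (1 - c) l, negative for 0
    < l < (1 - c) / 3. This choice gives - 2 / 25 (1 - c)^2 and keeps 2 c l \<le> 1, as
    \<open>exp_bound\<close> requires.\<close>
  define l where "l = (1 - c) / 5"
  define x y where "x = exp (- l)" and "y = exp (2 * c * l)"
  define p s where "p = real m / real (n choose 2)" and "s = card S"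
  have p0: "p \<ge> 0" by (simp add: p_def)
  have l: "0 < l" "l \<le> 1 / 5" using c by (auto simp: l_def)
  have E: "finite E" "card E = n choose 2" by (simp_all add: E_def finite_imp_finite_nsets)
  have ne: "nsets E m \<noteq> {}" "finite (nsets E m)"
    using m E by (metis card_nsets card.empty binomial_eq_0_iff not_less) (simp add: E finite_imp_finite_nsets)
  have cards: "card (induced_edges E S) = s choose 2" "card (boundary E S) = s * (n - s)"
    using S by (simp_all add: E_def induced_edges_nsets card_boundary_nsets s_def)
  have "measure_pmf.prob (pmf_of_set (nsets E m))
      {G. real (card (boundary G S)) \<le> 2 * c * real (card (induced_edges G S))}
     \<le> measure_pmf.prob (pmf_of_set (nsets E m))
        {G. y ^ card (G \<inter> induced_edges E S) * x ^ card (G \<inter> boundary E S) \<ge> 1}"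
  proof (rule prob_le_on_support)
    fix G assume G: "G \<in> set_pmf (pmf_of_set (nsets E m))"
      "G \<in> {G. real (card (boundary G S)) \<le> 2 * c * real (card (induced_edges G S))}"
    then have GE: "G \<subseteq> E" using ne by (auto simp: nsets_def)
    let ?a = "card (G \<inter> induced_edges E S)" and ?b = "card (G \<inter> boundary E S)"
    have ab: "real ?b \<le> 2 * c * real ?a"
      using G(2) by (simp add: induced_edges_eq_Int[OF GE] boundary_eq_Int[OF GE])
    have "y ^ ?a * x ^ ?b = exp (l * (2 * c * real ?a - real ?b))"
      by (simp add: x_def y_def exp_of_nat_mult[symmetric] exp_add[symmetric] algebra_simps)
    also have "\<dots> \<ge> 1" using ab l by simp
    finally show "G \<in> {G. y ^ card (G \<inter> induced_edges E S) * x ^ card (G \<inter> boundary E S) \<ge> 1}" by simp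
  qed
  also have "\<dots> \<le> (real (card E) + 1) * exp (real m / real (card E) *
      ((y - 1) * real (card (induced_edges E S)) + (x - 1) * real (card (boundary E S))))"
    using prob_weighted_counts_le[of E m "induced_edges E S" "boundary E S" x y 1] E m
      induced_boundary_disjoint[of E S]
    by (simp add: x_def y_def induced_edges_def boundary_def)
  also have "\<dots> = (real (n choose 2) + 1) * exp (p * ((y - 1) * real (s choose 2) + (x - 1) * real (s * (n - s))))"
    by (simp add: E cards p_def)
  also have "\<dots> \<le> (real (n choose 2) + 1) * exp (- (2 / 25 * (1 - c)\<^sup>2 * p * real s ^ 2))"
  proof (intro mult_left_mono iffD2[OF exp_le_cancel_iff])
    have cl': "0 \<le> c * l" "c * l \<le> l" using c l mult_right_mono[of c 1 l] by auto
    then have cl: "0 \<le> c * l" "c * l \<le> l" "c * l \<le> 1 / 5" using l(2) by linarith+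
    have "y \<le> 1 + 2 * c * l + (2 * c * l)\<^sup>2" unfolding y_def using cl by (intro exp_bound) auto
    also have "\<dots> \<le> 1 + 2 * (c * l) + 4 * l\<^sup>2"
      using power_mono[OF cl(2,1), of 2] by (simp add: power_mult_distrib)
    finally have y: "y - 1 \<le> 2 * (c * l) + 4 * l\<^sup>2" by simp
    have "x \<le> 1 / (1 + l)" unfolding x_def exp_minus using l exp_ge_add_one_self[of l]
      by (simp add: inverse_eq_divide frac_le)
    also have "\<dots> \<le> 1 - l + l\<^sup>2"
    proof -
      have "(1 - l + l\<^sup>2) * (1 + l) = 1 + l ^ 3" by (simp add: algebra_simps power2_eq_square power3_eq_cube)
      then have "1 \<le> (1 - l + l\<^sup>2) * (1 + l)" using l by simp
      then show ?thesis using l by (subst pos_divide_le_eq) auto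
    qed
    finally have x: "x - 1 \<le> - l + l\<^sup>2" by simp
    have "real (s choose 2) = real s * (real s - 1) / 2" by (rule real_choose_two)
    also have "\<dots> \<le> (real s)\<^sup>2 / 2" by (simp add: power2_eq_square algebra_simps)
    finally have s2: "real (s choose 2) \<le> (real s)\<^sup>2 / 2" .
    have "y \<ge> 1" using cl by (simp add: y_def)
    then have "(y - 1) * real (s choose 2) \<le> (y - 1) * ((real s)\<^sup>2 / 2)" using s2 by (intro mult_left_mono) auto
    moreover have "(x - 1) * real (s * (n - s)) \<le> (x - 1) * (real s)\<^sup>2"
    proof (rule mult_left_mono_neg)
      have "s * s \<le> s * (n - s)" using S by (intro mult_left_mono) (auto simp: s_def)
      then show "(real s)\<^sup>2 \<le> real (s * (n - s))" by (metis of_nat_le_iff of_nat_mult power2_eq_square)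
      show "x - 1 \<le> 0" using l by (simp add: x_def)
    qed
    ultimately have "(y - 1) * real (s choose 2) + (x - 1) * real (s * (n - s))
        \<le> (y - 1) * ((real s)\<^sup>2 / 2) + (x - 1) * (real s)\<^sup>2" by (rule add_mono)
    also have "\<dots> = ((y - 1) / 2 + (x - 1)) * (real s)\<^sup>2" by (simp add: field_simps)
    also have "\<dots> \<le> (- (2 / 25 * (1 - c)\<^sup>2)) * (real s)\<^sup>2"
    proof (intro mult_right_mono)
      have "(y - 1) / 2 + (x - 1) \<le> c * l + 2 * l\<^sup>2 - l + l\<^sup>2" using x y by argo
      also have "\<dots> = 3 * l\<^sup>2 - (1 - c) * l" by (simp add: algebra_simps)
      also have "1 - c = 5 * l" by (simp add: l_def)
      also have "3 * l\<^sup>2 - 5 * l * l = - (2 / 25 * (5 * l)\<^sup>2)" by (simp add: power2_eq_square)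
      also have "5 * l = 1 - c" by (simp add: l_def)
      finally show "(y - 1) / 2 + (x - 1) \<le> - (2 / 25 * (1 - c)\<^sup>2)" .
    qed simp
    finally have "p * ((y - 1) * real (s choose 2) + (x - 1) * real (s * (n - s)))
        \<le> p * ((- (2 / 25 * (1 - c)\<^sup>2)) * (real s)\<^sup>2)" using p0 by (intro mult_left_mono)
    then show "p * ((y - 1) * real (s choose 2) + (x - 1) * real (s * (n - s)))
        \<le> - (2 / 25 * (1 - c)\<^sup>2 * p * real s ^ 2)" by (simp add: mult_ac)
  qed simp
  finally show ?thesis by (simp add: p_def s_def)
qed

text \<open>Boundary edges get weight \<open>1 / 4\<close> and inner edges weight \<open>16 z\<close>: the factor \<open>16\<close> absorbs
  the boundary condition, and \<open>z = n / (100 s)\<close> turns the \<open>s - 1\<close> inner edges into a factor that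
  pays for the choice of \<open>S\<close>.\<close>

lemma prob_cut_medium:
  fixes n m :: nat
  defines "E \<equiv> nsets {..<n} 2"
  assumes m: "m \<le> n choose 2" and S: "S \<subseteq> {..<n}" "S \<noteq> {}" "100 * card S \<le> n"
  defines "s \<equiv> card S"
  shows "measure_pmf.prob (pmf_of_set (nsets E m))
      {G. card S \<le> card (induced_edges G S) + 1 \<and> card (boundary G S) \<le> 2 * card (induced_edges G S)}
    \<le> (real (n choose 2) + 1) * exp (- (real m / real (n choose 2) * real n * real s / 2)) * (100 * real s / real n) ^ (s - 1)"
proof -
  define z where "z = real n / (100 * real s)"
  define p where "p = real m / real (n choose 2)"
  have p0: "p \<ge> 0" by (simp add: p_def)
  have s0: "s > 0" using S finite_subset by (auto simp: s_def card_gt_0_iff)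
  have n0: "n > 0" using s0 S by (simp add: s_def)
  have z1: "z \<ge> 1" using S s0 by (simp add: z_def s_def)
  have E: "finite E" "card E = n choose 2" by (simp_all add: E_def finite_imp_finite_nsets)
  have ne: "nsets E m \<noteq> {}" "finite (nsets E m)"
    using m E by (metis card_nsets card.empty binomial_eq_0_iff not_less) (simp add: E finite_imp_finite_nsets)
  have cards: "card (induced_edges E S) = s choose 2" "card (boundary E S) = s * (n - s)"
    using S by (simp_all add: E_def induced_edges_nsets card_boundary_nsets s_def)
  let ?P = "measure_pmf.prob (pmf_of_set (nsets E m))
      {G. card S \<le> card (induced_edges G S) + 1 \<and> card (boundary G S) \<le> 2 * card (induced_edges G S)}"
  have "?P \<le> measure_pmf.prob (pmf_of_set (nsets E m))
        {G. (16 * z) ^ card (G \<inter> induced_edges E S) * (1 / 4) ^ card (G \<inter> boundary E S) \<ge> z ^ (s - 1)}"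
  proof (rule prob_le_on_support)
    fix G assume G: "G \<in> set_pmf (pmf_of_set (nsets E m))"
      "G \<in> {G. card S \<le> card (induced_edges G S) + 1 \<and> card (boundary G S) \<le> 2 * card (induced_edges G S)}"
    then have GE: "G \<subseteq> E" using ne by (auto simp: nsets_def)
    let ?a = "card (G \<inter> induced_edges E S)" and ?b = "card (G \<inter> boundary E S)"
    have "s \<le> ?a + 1" and ab: "?b \<le> 2 * ?a"
      using G(2) by (simp_all add: induced_edges_eq_Int[OF GE] boundary_eq_Int[OF GE] s_def)
    then have a: "s - 1 \<le> ?a" by linarith
    have "z ^ (s - 1) \<le> z ^ ?a" using a z1 by (intro power_increasing) auto
    also have "\<dots> = (16 * z) ^ ?a * (1 / 4) ^ (2 * ?a)"
      by (simp add: power_mult_distrib power_mult power_divide)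
    also have "\<dots> \<le> (16 * z) ^ ?a * (1 / 4) ^ ?b"
      using ab z1 by (intro mult_left_mono power_decreasing) auto
    finally show "G \<in> {G. (16 * z) ^ card (G \<inter> induced_edges E S) * (1 / 4) ^ card (G \<inter> boundary E S) \<ge> z ^ (s - 1)}"
      by simp
  qed
  then have "?P * z ^ (s - 1) \<le> measure_pmf.prob (pmf_of_set (nsets E m))
        {G. (16 * z) ^ card (G \<inter> induced_edges E S) * (1 / 4) ^ card (G \<inter> boundary E S) \<ge> z ^ (s - 1)} * z ^ (s - 1)"
    using z1 by (intro mult_right_mono) auto
  also have "\<dots> \<le> (real (card E) + 1) * exp (real m / real (card E) *
      ((16 * z - 1) * real (card (induced_edges E S)) + (1 / 4 - 1) * real (card (boundary E S))))"
    using E m induced_boundary_disjoint[of E S] z1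
    by (intro prob_weighted_counts_le) (auto simp: induced_edges_def boundary_def)
  also have "\<dots> = (real (n choose 2) + 1) * exp (p * ((16 * z - 1) * real (s choose 2) + (1 / 4 - 1) * real (s * (n - s))))"
    by (simp add: E cards p_def)
  also have "\<dots> \<le> (real (n choose 2) + 1) * exp (p * (- (real n * real s / 2)))"
  proof (intro mult_left_mono iffD2[OF exp_le_cancel_iff] p0)
    \<comment> \<open>With z = n / (100 s) the inner pairs contribute at most 0.08 n s to the
      exponent and the boundary pairs at most - 0.75 * 0.99 n s; the sum is below - n s / 2.\<close>
    have "real s * (real s - 1) \<le> real s * real s" by (intro mult_left_mono) auto
    then have s2: "real (s choose 2) \<le> real s * real s / 2" unfolding real_choose_two by simp
    have "(16 * z - 1) * real (s choose 2) \<le> (16 * z) * (real s * real s / 2)"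
      using s2 z1 by (intro mult_mono) auto
    also have "\<dots> = 8 / 100 * (real n * real s)" using s0 by (simp add: z_def field_simps)
    finally have 1: "(16 * z - 1) * real (s choose 2) \<le> 8 / 100 * (real n * real s)" .
    have "99 / 100 * real n \<le> real (n - s)" using S by (simp add: s_def of_nat_diff)
    then have "real s * (99 / 100 * real n) \<le> real s * real (n - s)" by (rule mult_left_mono) simp
    then have 2: "99 / 100 * (real n * real s) \<le> real (s * (n - s))" by (simp add: mult_ac)
    have arith: "a + (1 / 4 - 1) * b \<le> - (d / 2)" if "a \<le> 8 / 100 * d" "99 / 100 * d \<le> b" "0 \<le> d"
      for a b d :: real using that by argo
    show "(16 * z - 1) * real (s choose 2) + (1 / 4 - 1) * real (s * (n - s)) \<le> - (real n * real s / 2)"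
      by (rule arith[OF 1 2]) simp
  qed simp
  finally have "?P * z ^ (s - 1) \<le> (real (n choose 2) + 1) * exp (- (p * real n * real s / 2))"
    by (simp add: mult.assoc)
  then have "?P * z ^ (s - 1) * (1 / z) ^ (s - 1) \<le> (real (n choose 2) + 1) * exp (- (p * real n * real s / 2)) * (1 / z) ^ (s - 1)"
    using z1 by (intro mult_right_mono) auto
  moreover have "z ^ (s - 1) * (1 / z) ^ (s - 1) = 1" using z1 by (simp add: power_divide)
  moreover have "1 / z = 100 * real s / real n" by (simp add: z_def)
  ultimately have "?P \<le> (real (n choose 2) + 1) * exp (- (p * real n * real s / 2)) * (100 * real s / real n) ^ (s - 1)"
    by (simp only: mult.assoc mult_1_right)
  then show ?thesis unfolding p_def .
qed

text \<open>The choice of \<open>S\<close> costs at most about (e n / s) ^ s, by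
  \<open>n choose s\<close> \<le> n^s / s! and s! \<ge> (s / e) ^ s. The s - 1 inner edges of a
  connected set repay all factors n / s but one, which is bounded by the n on the right.\<close>

lemma binomial_mult_power_le:
  assumes "s > 0" "n > 0"
  shows "real (n choose s) * (100 * real s / real n) ^ (s - 1) \<le> real n * (100 * exp 1) ^ s"
proof -
  have f: "real (n choose s) * fact s \<le> real n ^ s"
    using binomial_fact_pow[of n s] by (metis of_nat_fact of_nat_le_iff of_nat_mult of_nat_power)
  have e: "real s ^ s \<le> exp 1 ^ s * fact s"
  proof -
    \<comment> \<open>The left side is a single term of the series of exp s.\<close>
    have "real s ^ s / fact s \<le> exp (real s)"
    proof -
      have "(\<lambda>k. real s ^ k / fact k) sums exp (real s)"
        using exp_converges[of "real s"] by (simp add: divide_inverse scaleR_conv_of_real mult.commute)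
      then show ?thesis using sum_le_suminf[of "\<lambda>k. real s ^ k / fact k" "{s}"]
        by (simp add: sums_iff)
    qed
    then show ?thesis by (simp add: exp_of_nat_mult[symmetric] divide_le_eq)
  qed
  obtain t where t: "s = Suc t" using assms by (cases s) auto
  have "real (n choose s) * (100 * real s / real n) ^ (s - 1) * (real n ^ t * fact s)
    = 100 ^ t * real s ^ t * (real (n choose s) * fact s)"
    using assms by (simp add: t power_mult_distrib power_divide del: of_nat_Suc fact_Suc binomial_Suc_Suc)
  also have "\<dots> \<le> 100 ^ s * real s ^ s * real n ^ s"
  proof (intro mult_mono f)
    show "real s ^ t \<le> real s ^ s" using assms t by (intro power_increasing) auto
    show "(100::real) ^ t \<le> 100 ^ s" using t by (intro power_increasing) auto
  qed (auto simp del: of_nat_Suc)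
  also have "\<dots> \<le> 100 ^ s * (exp 1 ^ s * fact s) * real n ^ s"
    by (intro mult_right_mono mult_left_mono e) auto
  also have "\<dots> = real n * (100 * exp 1) ^ s * (real n ^ t * fact s)"
    by (simp add: t power_mult_distrib del: of_nat_Suc fact_Suc)
  finally show ?thesis using assms by (simp only: mult_le_cancel_right) (auto simp del: fact_Suc)
qed

text \<open>\<open>F\<close> is left open because three cases occur: no edge late in the process,
  one edge while the other is about to appear, and both edges at the start. The pairs of
  \<open>F\<close> lie inside the triple, hence outside its 3 (n - 3) boundary pairs, and both
  requirements can be counted together.\<close>

lemma prob_low_triple:
  fixes n m k :: nat
  defines "E \<equiv> nsets {..<n} 2" and "p \<equiv> real m / real (n choose 2)"
  assumes m: "m \<le> n choose 2" and uvw: "{u, v, w} \<subseteq> {..<n}" "u \<noteq> v" "v \<noteq> w" "u \<noteq> w"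
    and F: "F \<subseteq> {{u, v}, {v, w}}"
  shows "measure_pmf.prob (pmf_of_set (nsets E m)) {G. F \<subseteq> G \<and> card (boundary G {u, v, w}) \<le> k}
    \<le> (real k + 1) * (1 + 3 * real (n - 3) * p) ^ k * p ^ card F * exp (2 * real k + real (card F))
       * exp (- (3 * real (n - 3) * p))"
proof -
  have E: "finite E" "card E = n choose 2" by (simp_all add: E_def finite_imp_finite_nsets)
  have ne: "nsets E m \<noteq> {}" "finite (nsets E m)"
    using m E by (metis card_nsets card.empty binomial_eq_0_iff not_less) (simp add: E finite_imp_finite_nsets)
  have c3: "card {u, v, w} = 3" using uvw by simp
  have cb: "card (boundary E {u, v, w}) = 3 * (n - 3)"
    unfolding E_def using card_boundary_nsets[of "{..<n}" "{u, v, w}"] uvw(1) c3 by simp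
  have "measure_pmf.prob (pmf_of_set (nsets E m)) {G. F \<subseteq> G \<and> card (boundary G {u, v, w}) \<le> k}
    \<le> measure_pmf.prob (pmf_of_set (nsets E m)) {G. F \<subseteq> G \<and> card (G \<inter> boundary E {u, v, w}) \<le> k}"
  proof (rule prob_le_on_support)
    fix G assume G: "G \<in> set_pmf (pmf_of_set (nsets E m))" "G \<in> {G. F \<subseteq> G \<and> card (boundary G {u, v, w}) \<le> k}"
    then have GE: "G \<subseteq> E" using ne by (auto simp: nsets_def)
    show "G \<in> {G. F \<subseteq> G \<and> card (G \<inter> boundary E {u, v, w}) \<le> k}"
      using G(2) by (simp add: boundary_eq_Int[OF GE])
  qed
  also have "\<dots> \<le> (real k + 1) * (1 + real (card (boundary E {u, v, w})) * (real m / real (card E))) ^ k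
     * (real m / real (card E)) ^ card F * exp (2 * real k + real (card F))
       * exp (- (real (card (boundary E {u, v, w})) * (real m / real (card E))))"
    using E m F uvw by (intro prob_superset_few_le) (auto simp: E_def boundary_def)
  finally show ?thesis by (simp add: cb E p_def)
qed

text \<open>The middle entry is the centre of the path. Each path occurs in both orientations, so
  that \<open>{u, v}\<close> may be taken to be the edge that appears last.\<close>

definition triples :: "nat \<Rightarrow> (nat \<times> nat \<times> nat) set" where
  "triples n = {(u, v, w). {u, v, w} \<subseteq> {..<n} \<and> u \<noteq> v \<and> v \<noteq> w \<and> u \<noteq> w}"

lemma finite_triples: "finite (triples n)" and card_triples_le: "card (triples n) \<le> n ^ 3"
proof -
  have sub: "triples n \<subseteq> {..<n} \<times> {..<n} \<times> {..<n}" by (auto simp: triples_def)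
  then show "finite (triples n)" by (rule finite_subset) auto
  show "card (triples n) \<le> n ^ 3"
    using card_mono[OF _ sub] by (simp add: card_cartesian_product power3_eq_cube)
qed

text \<open>The constant is \<open>6912 = 3 * 48\<^sup>2\<close>: at most \<open>48\<^sup>2\<close> inner edges and twice as many boundary edges.\<close>

lemma not_resilient_cases:
  fixes \<alpha> :: real
  assumes G: "G \<subseteq> nsets {..<n} 2" and C: "C \<in> components {..<n} G"
    and \<alpha>: "0 \<le> \<alpha>" "\<alpha> < 1 / 2"
    and nres: "\<not> resilient \<alpha> connected_graph C (induced_edges G C)"
  obtains (triple) u v w where "(u, v, w) \<in> triples n" "{u, v} \<in> G" "{v, w} \<in> G"
      "card (boundary G {u, v, w}) \<le> 6912"
  | (medium) S where "S \<subseteq> {..<n}" "48 < card S" "100 * card S \<le> n"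
      "card S \<le> card (induced_edges G S) + 1" "card (boundary G S) \<le> 2 * card (induced_edges G S)"
  | (large) S where "S \<subseteq> {..<n}" "n < 100 * card S" "2 * card S \<le> n"
      "real (card (boundary G S)) \<le> 2 * (\<alpha> / (1 - \<alpha>)) * real (card (induced_edges G S))"
proof -
  obtain H where H: "H \<subseteq> induced_edges G C"
    "\<And>v. v \<in> C \<Longrightarrow> real (degree_in H v) \<le> \<alpha> * real (degree_in (induced_edges G C) v)"
    "\<not> connected_graph C (induced_edges G C - H)"
    using nres by (auto simp: resilient_def)
  obtain S u v w where S: "S \<subseteq> {..<n}" "S \<noteq> {}" "2 * card S \<le> card {..<n}"
    "card S \<le> card (induced_edges G S) + 1"
    "(1 - \<alpha>) * real (card (boundary G S)) \<le> 2 * \<alpha> * real (card (induced_edges G S))"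
    "{u, v, w} \<subseteq> S" "u \<noteq> v" "v \<noteq> w" "u \<noteq> w" "{u, v} \<in> G" "{v, w} \<in> G"
    using disconnected_imp_cut[OF _ G C H(1,2) \<alpha> H(3)] by blast
  have finS: "finite S" using S finite_subset by auto
  have finG: "finite G" using G by (rule finite_subset) (simp add: finite_imp_finite_nsets)
  let ?a = "card (induced_edges G S)" and ?b = "card (boundary G S)"
  \<comment> \<open>The quotient \<alpha> / (1 - \<alpha>) is below 1 because \<alpha> < 1 / 2; this
    gap is what makes large cuts unlikely.\<close>
  have cut: "real ?b \<le> 2 * (\<alpha> / (1 - \<alpha>)) * real ?a"
    using S(5) \<alpha> by (simp add: pos_le_divide_eq mult.commute)
  have "2 * (\<alpha> / (1 - \<alpha>)) * real ?a \<le> 2 * 1 * real ?a"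
    using \<alpha> by (intro mult_right_mono mult_left_mono) (auto simp: divide_le_eq)
  then have cut2: "?b \<le> 2 * ?a" using cut by linarith
  show ?thesis
  proof (cases "48 < card S")
    case True
    then show ?thesis using S cut cut2 medium[of S] large[of S] by (cases "100 * card S \<le> n") auto
  next
    case False
    have "?a \<le> card (nsets S 2)"
      using G finS by (intro card_mono) (auto simp: finite_imp_finite_nsets induced_edges_def nsets_def)
    also have "\<dots> \<le> card S ^ 2"
      by (cases "2 \<le> card S") (auto simp: binomial_le_pow binomial_eq_0)
    also have "\<dots> \<le> 48 ^ 2" using False by (intro power_mono) auto
    finally have a: "?a \<le> 2304" by simp
    \<comment> \<open>An edge leaving the triple either stays in \<open>S\<close> or leaves
      \<open>S\<close>, and both kinds are few when \<open>S\<close> is small.\<close>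
    have "boundary G {u, v, w} \<subseteq> induced_edges G S \<union> boundary G S"
      using S by (auto simp: boundary_def induced_edges_def)
    then have "card (boundary G {u, v, w}) \<le> ?a + ?b"
      using finG by (intro order_trans[OF card_mono card_Un_le]) (auto simp: boundary_def induced_edges_def)
    also have "\<dots> \<le> 6912" using a cut2 by simp
    finally show ?thesis using S by (intro triple[of u v w]) (auto simp: triples_def)
  qed
qed

text \<open>Low boundaries are inherited by earlier graphs, so a path with low boundary is either present
  from the start or created by a single new edge next to an old one.\<close>

lemma low_path_emerges:
  assumes step: "\<And>m. m < M \<Longrightarrow> \<exists>e. G (Suc m) = insert e (G m)" and fin: "\<And>m. m \<le> M \<Longrightarrow> finite (G m)"
    and m: "m0 \<le> m" "m \<le> m1" "m1 \<le> M"
    and t: "(u, v, w) \<in> triples n" "{u, v} \<in> G m" "{v, w} \<in> G m" "card (boundary (G m) {u, v, w}) \<le> k"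
  shows "(\<exists>(u, v, w)\<in>triples n. {{u, v}, {v, w}} \<subseteq> G m0 \<and> card (boundary (G m0) {u, v, w}) \<le> k) \<or>
    (\<exists>m\<in>{m0..<m1}. \<exists>(u, v, w)\<in>triples n. ({{v, w}} \<subseteq> G m \<and> card (boundary (G m) {u, v, w}) \<le> k) \<and>
        {u, v} \<in> G (Suc m) - G m)"
  using m t
proof (induction m arbitrary: u v w rule: dec_induct)
  case base
  then show ?case by auto
next
  case (step i)
  have uvw: "u \<noteq> v" "v \<noteq> w" "u \<noteq> w" using step.prems by (auto simp: triples_def)
  obtain e where e: "G (Suc i) = insert e (G i)" using assms(1)[of i] step by auto
  have "card (boundary (G i) {u, v, w}) \<le> card (boundary (G (Suc i)) {u, v, w})"
    using fin[of "Suc i"] step e by (intro card_mono boundary_mono) (auto simp: boundary_def)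
  then have low: "card (boundary (G i) {u, v, w}) \<le> k" using step by simp
  have ne: "{u, v} \<noteq> {v, w}" using uvw by (auto simp: doubleton_eq_iff)
  consider "{u, v} \<in> G i" "{v, w} \<in> G i" | "{u, v} \<notin> G i" "{v, w} \<in> G i" | "{u, v} \<in> G i" "{v, w} \<notin> G i"
    using e ne step.prems by auto
  then show ?case
  proof cases
    case 1
    then show ?thesis using step.IH[of u v w] step.prems low by simp
  next
    case 2
    then have "\<exists>m\<in>{m0..<m1}. \<exists>(u, v, w)\<in>triples n. ({{v, w}} \<subseteq> G m \<and> card (boundary (G m) {u, v, w}) \<le> k) \<and>
        {u, v} \<in> G (Suc m) - G m"
      using step low by (intro bexI[of _ i] bexI[of _ "(u, v, w)"]) auto
    then show ?thesis by blast
  next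
    case 3
    have eqs: "{w, v} = {v, w}" "{v, u} = {u, v}" "{w, v, u} = {u, v, w}" by auto
    have "(w, v, u) \<in> triples n" using step.prems(3) by (auto simp: triples_def)
    then have "\<exists>m\<in>{m0..<m1}. \<exists>(u, v, w)\<in>triples n. ({{v, w}} \<subseteq> G m \<and> card (boundary (G m) {u, v, w}) \<le> k) \<and>
        {u, v} \<in> G (Suc m) - G m"
    proof (intro bexI)
      show "case (w, v, u) of (u, v, w) \<Rightarrow> ({{v, w}} \<subseteq> G i \<and> card (boundary (G i) {u, v, w}) \<le> k) \<and>
          {u, v} \<in> G (Suc i) - G i"
        using 3 step.prems low by (simp add: insert_commute)
    qed (use \<open>(w, v, u) \<in> triples n\<close> step in auto)
    then show ?thesis by blast
  qed
qed

section \<open>Union bounds over triples, cuts and times\<close>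

lemma prob_bex_le:
  assumes "finite I" "\<And>i. i \<in> I \<Longrightarrow> measure_pmf.prob M {x. P i x} \<le> b i"
  shows "measure_pmf.prob M {x. \<exists>i\<in>I. P i x} \<le> (\<Sum>i\<in>I. b i)"
proof -
  have "{x. \<exists>i\<in>I. P i x} = (\<Union>i\<in>I. {x. P i x})" by auto
  then have "measure_pmf.prob M {x. \<exists>i\<in>I. P i x} \<le> (\<Sum>i\<in>I. measure_pmf.prob M {x. P i x})"
    using assms(1) measure_pmf.finite_measure_subadditive_finite[of I "\<lambda>i. {x. P i x}" M] by simp
  also have "\<dots> \<le> (\<Sum>i\<in>I. b i)" using assms(2) by (rule sum_mono)
  finally show ?thesis .
qed

lemma prob_disj_le:
  assumes "measure_pmf.prob M {x. P x} \<le> a" "measure_pmf.prob M {x. Q x} \<le> b"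
  shows "measure_pmf.prob M {x. P x \<or> Q x} \<le> a + b"
proof -
  have "{x. P x \<or> Q x} = {x. P x} \<union> {x. Q x}" by auto
  then show ?thesis using measure_Un_le[of "{x. P x}" M "{x. Q x}"] assms by simp
qed

text \<open>Here \<open>p\<close> and \<open>q\<close> are a lower and an upper bound for the edge density.\<close>

definition low_bound :: "nat \<Rightarrow> nat \<Rightarrow> nat \<Rightarrow> real \<Rightarrow> real \<Rightarrow> real" where
  "low_bound k f n p q = (real k + 1) * (1 + 3 * real (n - 3) * q) ^ k * q ^ f
     * exp (2 * real k + real f) * exp (- (3 * real (n - 3) * p))"

lemma low_bound_nonneg: "q \<ge> 0 \<Longrightarrow> low_bound k f n p q \<ge> 0"
  by (simp add: low_bound_def)

text \<open>The decaying factor is taken at the lower density and the growing ones at the upper, so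
  one number serves for a whole range of times.\<close>

lemma prob_low_triple_between:
  fixes n m k :: nat
  assumes m: "m \<le> n choose 2" and uvw: "(u, v, w) \<in> triples n"
    and F: "F \<subseteq> {{u, v}, {v, w}}"
    and pq: "p \<le> real m / real (n choose 2)" "real m / real (n choose 2) \<le> q"
  shows "measure_pmf.prob (pmf_of_set (nsets (nsets {..<n} 2) m)) {G. F \<subseteq> G \<and> card (boundary G {u, v, w}) \<le> k}
    \<le> low_bound k (card F) n p q"
proof -
  define r where "r = real m / real (n choose 2)"
  have r: "0 \<le> r" "p \<le> r" "r \<le> q" using pq by (auto simp: r_def)
  have "measure_pmf.prob (pmf_of_set (nsets (nsets {..<n} 2) m)) {G. F \<subseteq> G \<and> card (boundary G {u, v, w}) \<le> k}
    \<le> low_bound k (card F) n r r"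
    unfolding low_bound_def r_def using uvw by (intro prob_low_triple m F) (auto simp: triples_def)
  also have "\<dots> \<le> low_bound k (card F) n p q"
    unfolding low_bound_def using r
    by (intro mult_mono power_mono add_left_mono mult_left_mono mult_nonneg_nonneg) (auto intro!: mult_left_mono)
  finally show ?thesis .
qed

text \<open>Applied with \<open>F\<close> empty at the later time, where a low boundary alone is
  rare enough for all n^3 triples, and with both edges at the initial time.\<close>

lemma prob_exists_low_triple:
  assumes m: "m \<le> n choose 2" and F: "\<And>u v w. F u v w \<subseteq> {{u, v}, {v, w}}"
     "\<And>u v w. (u, v, w) \<in> triples n \<Longrightarrow> card (F u v w) = f"
    and pq: "p \<le> real m / real (n choose 2)" "real m / real (n choose 2) \<le> q"
  shows "measure_pmf.prob (graph_process n (n choose 2))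
      {Gs. \<exists>(u, v, w)\<in>triples n. F u v w \<subseteq> Gs ! m \<and> card (boundary (Gs ! m) {u, v, w}) \<le> k}
    \<le> real n ^ 3 * low_bound k f n p q"
proof -
  have q0: "0 \<le> q" using pq(2) by (rule order_trans[rotated]) simp
  have "measure_pmf.prob (graph_process n (n choose 2))
      {Gs. \<exists>t\<in>triples n. case t of (u, v, w) \<Rightarrow> F u v w \<subseteq> Gs ! m \<and> card (boundary (Gs ! m) {u, v, w}) \<le> k}
    \<le> (\<Sum>t\<in>triples n. low_bound k f n p q)"
  proof (rule prob_bex_le[OF finite_triples])
    fix t assume t: "t \<in> triples n"
    obtain u v w where uvw: "t = (u, v, w)" by (cases t)
    show "measure_pmf.prob (graph_process n (n choose 2))
      {Gs. case t of (u, v, w) \<Rightarrow> F u v w \<subseteq> Gs ! m \<and> card (boundary (Gs ! m) {u, v, w}) \<le> k}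
      \<le> low_bound k f n p q"
      using prob_graph_process_nth[OF m m, where Q = "\<lambda>G. F u v w \<subseteq> G \<and> card (boundary G {u, v, w}) \<le> k"]
        prob_low_triple_between[OF m t[unfolded uvw] F(1) pq, of k] F(2)[of u v w] t uvw by simp
  qed
  also have "\<dots> \<le> real (n ^ 3) * low_bound k f n p q"
    using card_triples_le[of n] low_bound_nonneg[OF q0]
    by (simp only: sum_constant) (intro mult_right_mono of_nat_mono)
  finally show ?thesis by simp
qed

text \<open>Summed over the times below \<open>m1\<close>, the probabilities of the last edge add up
  to at most m1 / ((n choose 2) - m1), again of the order of a density. The result therefore has the
  order of the bound for both edges being present at once.\<close>

lemma prob_low_path_created:
  assumes m: "m0 \<le> m1" "m1 < n choose 2"
    and pq: "p \<le> real m0 / real (n choose 2)" "real m1 / real (n choose 2) \<le> q"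
  shows "measure_pmf.prob (graph_process n (n choose 2))
      {Gs. \<exists>m\<in>{m0..<m1}. \<exists>(u, v, w)\<in>triples n. ({{v, w}} \<subseteq> Gs ! m \<and> card (boundary (Gs ! m) {u, v, w}) \<le> k)
          \<and> {u, v} \<in> Gs ! Suc m - Gs ! m}
    \<le> real m1 * (real n ^ 3 * (low_bound k 1 n p q / real ((n choose 2) - m1)))"
proof -
  let ?N = "n choose 2"
  have q0: "0 \<le> q" using pq(2) by (rule order_trans[rotated]) simp
  define b where "b = low_bound k 1 n p q / real (?N - m1)"
  have b0: "b \<ge> 0" unfolding b_def by (intro divide_nonneg_nonneg low_bound_nonneg q0) auto
  have "measure_pmf.prob (graph_process n ?N)
      {Gs. \<exists>m\<in>{m0..<m1}. \<exists>t\<in>triples n. case t of (u, v, w) \<Rightarrow>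
         ({{v, w}} \<subseteq> Gs ! m \<and> card (boundary (Gs ! m) {u, v, w}) \<le> k) \<and> {u, v} \<in> Gs ! Suc m - Gs ! m}
      \<le> (\<Sum>m\<in>{m0..<m1}. \<Sum>t\<in>triples n. b)"
  proof (rule prob_bex_le, simp, rule prob_bex_le[OF finite_triples])
    fix m t assume m': "m \<in> {m0..<m1}" and t: "t \<in> triples n"
    obtain u v w where uvw: "t = (u, v, w)" by (cases t)
    have mN: "m < ?N" using m' m by simp
    have pq': "p \<le> real m / real ?N" "real m / real ?N \<le> q"
      using m' by (auto intro!: order_trans[OF pq(1) divide_right_mono] order_trans[OF divide_right_mono pq(2)])
    let ?Q = "\<lambda>G. {{v, w}} \<subseteq> G \<and> card (boundary G {u, v, w}) \<le> k"
    have "measure_pmf.prob (graph_process n ?N) {Gs. ?Q (Gs ! m) \<and> {u, v} \<in> Gs ! Suc m - Gs ! m}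
       \<le> measure_pmf.prob (pmf_of_set (nsets (nsets {..<n} 2) m)) {G. ?Q G} / real (?N - m)"
      by (rule prob_graph_process_new_edge[OF mN order_refl])
    also have "\<dots> \<le> low_bound k 1 n p q / real (?N - m)"
    proof (rule divide_right_mono)
      show "measure_pmf.prob (pmf_of_set (nsets (nsets {..<n} 2) m)) {G. ?Q G} \<le> low_bound k 1 n p q"
        using prob_low_triple_between[of m n u v w "{{v, w}}" p q k] mN t uvw pq' by simp
    qed simp
    also have "\<dots> \<le> b" unfolding b_def using m' m
      by (intro divide_left_mono low_bound_nonneg q0) auto
    finally show "measure_pmf.prob (graph_process n ?N) {Gs. case t of (u, v, w) \<Rightarrow>
         ({{v, w}} \<subseteq> Gs ! m \<and> card (boundary (Gs ! m) {u, v, w}) \<le> k) \<and> {u, v} \<in> Gs ! Suc m - Gs ! m} \<le> b"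
      by (simp add: uvw)
  qed
  also have "\<dots> = real (m1 - m0) * (real (card (triples n)) * b)" by simp
  also have "\<dots> \<le> real m1 * (real (n ^ 3) * b)"
    using card_triples_le[of n] b0 by (intro mult_mono mult_right_mono of_nat_mono mult_nonneg_nonneg) auto
  finally show ?thesis by (simp add: b_def)
qed

text \<open>The base on the right is of order n powr (- 1 / 6) at the threshold, and as it is at
  most 1, the smallest size dominates. The cut-off 48 yields n powr (- 8), enough against the n^6
  from the comparison with the binomial model, the later union over m, the union over s and the
  surplus factor of \<open>binomial_mult_power_le\<close>.\<close>

lemma prob_exists_medium_cut:
  assumes m: "m \<le> n choose 2" and p: "p \<le> real m / real (n choose 2)"
    and q: "100 * exp 1 * exp (- (p * real n / 2)) \<le> 1"
  shows "measure_pmf.prob (graph_process n (n choose 2))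
      {Gs. \<exists>S. S \<subseteq> {..<n} \<and> 48 < card S \<and> 100 * card S \<le> n \<and>
         card S \<le> card (induced_edges (Gs ! m) S) + 1 \<and> card (boundary (Gs ! m) S) \<le> 2 * card (induced_edges (Gs ! m) S)}
    \<le> (real (n choose 2) + 1) * real n ^ 2 * (100 * exp 1 * exp (- (p * real n / 2))) ^ 48"
proof -
  let ?N = "n choose 2"
  define r where "r = real m / real ?N"
  define a where "a = 100 * exp 1 * exp (- (p * real n / 2))"
  define I where "I = {s \<in> {..<n}. 48 < s \<and> 100 * s \<le> n}"
  let ?P = "\<lambda>S G. card S \<le> card (induced_edges G S) + 1 \<and> card (boundary G S) \<le> 2 * card (induced_edges G S)"
  have a: "0 \<le> a" "a \<le> 1" using q by (auto simp: a_def)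
  have "measure_pmf.prob (graph_process n ?N) {Gs. \<exists>S. S \<subseteq> {..<n} \<and> 48 < card S \<and> 100 * card S \<le> n \<and> ?P S (Gs ! m)}
    \<le> measure_pmf.prob (graph_process n ?N) {Gs. \<exists>s\<in>I. \<exists>S\<in>nsets {..<n} s. ?P S (Gs ! m)}"
  proof (rule prob_le_on_support)
    fix Gs assume "Gs \<in> {Gs. \<exists>S. S \<subseteq> {..<n} \<and> 48 < card S \<and> 100 * card S \<le> n \<and> ?P S (Gs ! m)}"
    then obtain S where S: "S \<subseteq> {..<n}" "48 < card S" "100 * card S \<le> n" "?P S (Gs ! m)" by auto
    have "finite S" using S(1) finite_subset by blast
    moreover have "card S \<in> I" using S by (auto simp: I_def)
    ultimately show "Gs \<in> {Gs. \<exists>s\<in>I. \<exists>S\<in>nsets {..<n} s. ?P S (Gs ! m)}"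
      using S by (auto simp: nsets_def)
  qed
  also have "\<dots> \<le> (\<Sum>s\<in>I. \<Sum>S\<in>nsets {..<n} s. (real ?N + 1) * exp (- (r * real n * real s / 2)) * (100 * real s / real n) ^ (s - 1))"
  proof (rule prob_bex_le, simp add: I_def, rule prob_bex_le)
    fix s S assume s: "s \<in> I" and S: "S \<in> nsets {..<n} s"
    have S': "S \<subseteq> {..<n}" "card S = s" "S \<noteq> {}" "100 * card S \<le> n" using s S by (auto simp: nsets_def I_def)
    show "measure_pmf.prob (graph_process n ?N) {Gs. ?P S (Gs ! m)}
      \<le> (real ?N + 1) * exp (- (r * real n * real s / 2)) * (100 * real s / real n) ^ (s - 1)"
      using prob_graph_process_nth[OF m m, where Q = "?P S"] prob_cut_medium[OF m S'(1,3,4)]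
      unfolding r_def S'(2) by simp
  qed (simp add: finite_imp_finite_nsets)
  also have "\<dots> \<le> (\<Sum>s\<in>I. (real ?N + 1) * (real n * a ^ 48))"
  proof (rule sum_mono)
    fix s assume s: "s \<in> I"
    then have s0: "0 < s" "0 < n" "48 \<le> s" by (auto simp: I_def)
    have "exp (- (r * real n * real s / 2)) \<le> exp (- (p * real n / 2)) ^ s"
    proof -
      have "p * (real n * real s) \<le> r * (real n * real s)" using p by (intro mult_right_mono) (auto simp: r_def)
      then show ?thesis by (simp add: exp_of_nat_mult[symmetric] mult_ac)
    qed
    then have "(real (n choose s) * (100 * real s / real n) ^ (s - 1)) * exp (- (r * real n * real s / 2))
        \<le> (real n * (100 * exp 1) ^ s) * exp (- (p * real n / 2)) ^ s"
      using s0 by (intro mult_mono binomial_mult_power_le) auto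
    also have "\<dots> = real n * a ^ s" by (simp add: a_def power_mult_distrib)
    also have "\<dots> \<le> real n * a ^ 48" using a s0 by (intro mult_left_mono power_decreasing) auto
    finally have "(real ?N + 1) * ((real (n choose s) * (100 * real s / real n) ^ (s - 1)) * exp (- (r * real n * real s / 2)))
       \<le> (real ?N + 1) * (real n * a ^ 48)" by (rule mult_left_mono) simp
    then show "(\<Sum>S\<in>nsets {..<n} s. (real ?N + 1) * exp (- (r * real n * real s / 2)) * (100 * real s / real n) ^ (s - 1))
       \<le> (real ?N + 1) * (real n * a ^ 48)" by (simp add: mult_ac)
  qed
  also have "\<dots> \<le> real n * ((real ?N + 1) * (real n * a ^ 48))"
  proof -
    have "card I \<le> card {..<n}" by (intro card_mono) (auto simp: I_def)
    then show ?thesis using a by (simp only: sum_constant) (intro mult_right_mono mult_nonneg_nonneg, auto)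
  qed
  finally show ?thesis by (simp add: a_def power2_eq_square mult_ac)
qed

text \<open>All 2 ^ n sets may be counted, since for linear size the exponent is of order p n^2,
  that is n ln n at the threshold.\<close>

lemma prob_exists_large_cut:
  fixes c :: real
  assumes m: "m \<le> n choose 2" and p: "0 \<le> p" "p \<le> real m / real (n choose 2)" and c: "0 \<le> c" "c < 1"
  shows "measure_pmf.prob (graph_process n (n choose 2))
      {Gs. \<exists>S. S \<subseteq> {..<n} \<and> n < 100 * card S \<and> 2 * card S \<le> n \<and>
         real (card (boundary (Gs ! m) S)) \<le> 2 * c * real (card (induced_edges (Gs ! m) S))}
    \<le> (real (n choose 2) + 1) * 2 ^ n * exp (- (2 / 25 * (1 - c)\<^sup>2 * p * (real n / 100) ^ 2))"
proof -
  let ?N = "n choose 2"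
  define r where "r = real m / real ?N"
  define I where "I = {S \<in> Pow {..<n}. n < 100 * card S \<and> 2 * card S \<le> n}"
  define b where "b = (real ?N + 1) * exp (- (2 / 25 * (1 - c)\<^sup>2 * p * (real n / 100) ^ 2))"
  let ?P = "\<lambda>S G. real (card (boundary G S)) \<le> 2 * c * real (card (induced_edges G S))"
  have "measure_pmf.prob (graph_process n ?N) {Gs. \<exists>S. S \<subseteq> {..<n} \<and> n < 100 * card S \<and> 2 * card S \<le> n \<and> ?P S (Gs ! m)}
    = measure_pmf.prob (graph_process n ?N) {Gs. \<exists>S\<in>I. ?P S (Gs ! m)}"
    by (rule arg_cong[where f = "measure_pmf.prob _"]) (auto simp: I_def)
  also have "\<dots> \<le> (\<Sum>S\<in>I. b)"
  proof (rule prob_bex_le)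
    fix S assume "S \<in> I"
    then have S: "S \<subseteq> {..<n}" "n < 100 * card S" "2 * card S \<le> n" by (auto simp: I_def)
    have "measure_pmf.prob (graph_process n ?N) {Gs. ?P S (Gs ! m)}
      \<le> (real ?N + 1) * exp (- (2 / 25 * (1 - c)\<^sup>2 * r * real (card S) ^ 2))"
      using prob_graph_process_nth[OF m m, where Q = "?P S"] prob_cut_large[OF m c S(1,3)]
      unfolding r_def by simp
    also have "\<dots> \<le> b"
    proof -
      have "(real n / 100) ^ 2 \<le> real (card S) ^ 2" using S by (intro power_mono) auto
      then have "p * (real n / 100) ^ 2 \<le> r * real (card S) ^ 2" using p by (intro mult_mono) (auto simp: r_def)
      then have "2 / 25 * (1 - c)\<^sup>2 * (p * (real n / 100) ^ 2) \<le> 2 / 25 * (1 - c)\<^sup>2 * (r * real (card S) ^ 2)"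
        by (rule mult_left_mono) simp
      then show ?thesis unfolding b_def by (intro mult_left_mono) (simp_all add: mult.assoc)
    qed
    finally show "measure_pmf.prob (graph_process n ?N) {Gs. ?P S (Gs ! m)} \<le> b" .
  qed (simp add: I_def)
  also have "\<dots> \<le> 2 ^ n * b"
  proof -
    have "card I \<le> card (Pow {..<n})" by (intro card_mono) (auto simp: I_def)
    then have "card I \<le> 2 ^ n" by (simp add: card_Pow)
    then have "real (card I) \<le> 2 ^ n" by (metis of_nat_le_iff of_nat_numeral of_nat_power)
    moreover have "b \<ge> 0" by (simp add: b_def)
    ultimately show ?thesis by (simp only: sum_constant) (rule mult_right_mono)
  qed
  finally show ?thesis by (simp add: b_def mult_ac)
qed

subsection \<open>The whole process\<close>

lemma graph_process_mono:
  assumes Gs: "Gs \<in> set_pmf (graph_process n k)" and m: "i \<le> m" "m \<le> k" and k: "k \<le> n choose 2"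
  shows "Gs ! i \<subseteq> Gs ! m"
  using m
proof (induction m rule: dec_induct)
  case (step j)
  then show ?case using graph_process_nth_Suc[OF Gs, of j] k by auto
qed simp

text \<open>\<open>m0\<close> is the threshold time and \<open>m1\<close> the later time from which
  low triples are ruled out all at once. The summands belong to a low triple at \<open>m1\<close>, a
  low path at \<open>m0\<close>, a low path completed in between, a medium cut and a large cut; only
  the last two pay N + 1 for the union over all m.\<close>

lemma prob_not_resilient_le:
  fixes n m0 m1 :: nat and \<alpha> p p' q :: real
  defines "N \<equiv> n choose 2" and "a \<equiv> 100 * exp 1 * exp (- (p * real n / 2))"
  assumes m: "m0 \<le> m1" "m1 < N" and \<alpha>: "0 \<le> \<alpha>" "\<alpha> < 1 / 2"
    and p: "0 \<le> p" "p \<le> real m0 / real N" and p': "p' \<le> real m1 / real N"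
    and q: "real m1 / real N \<le> q" and a: "a \<le> 1"
  shows "measure_pmf.prob (graph_process n N)
      {Gs. \<exists>m\<in>{m0..N}. \<exists>C\<in>components {..<n} (Gs ! m).
         \<not> resilient \<alpha> connected_graph C (induced_edges (Gs ! m) C)}
    \<le> real n ^ 3 * low_bound 6912 0 n p' q
      + (real n ^ 3 * low_bound 6912 2 n p q
      + (real m1 * (real n ^ 3 * (low_bound 6912 1 n p q / real (N - m1)))
      + ((real N + 1) * ((real N + 1) * real n ^ 2 * a ^ 48)
      + (real N + 1) * ((real N + 1) * 2 ^ n *
          exp (- (2 / 25 * (1 - \<alpha> / (1 - \<alpha>))\<^sup>2 * p * (real n / 100) ^ 2))))))"
    (is "measure_pmf.prob _ ?bad \<le> ?b1 + (?b2 + (?b3 + (?b4 + ?b5)))")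
proof -
  define c where "c = \<alpha> / (1 - \<alpha>)"
  have c: "0 \<le> c" "c < 1" using \<alpha> by (auto simp: c_def divide_less_eq)
  let ?M = "graph_process n N"
  let ?low = "\<lambda>G u v w. card (boundary G {u, v, w}) \<le> 6912"
  \<comment> \<open>The vacuous inclusion keeps the shape of \<open>prob_exists_low_triple\<close>
    for empty \<open>F\<close>.\<close>
  define X1 where "X1 Gs \<longleftrightarrow> (\<exists>(u, v, w)\<in>triples n. {} \<subseteq> Gs ! m1 \<and> ?low (Gs ! m1) u v w)" for Gs :: "nat set set list"
  define X2 where "X2 Gs \<longleftrightarrow> (\<exists>(u, v, w)\<in>triples n. {{u, v}, {v, w}} \<subseteq> Gs ! m0 \<and> ?low (Gs ! m0) u v w)" for Gs :: "nat set set list"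
  define X3 where "X3 Gs \<longleftrightarrow> (\<exists>m\<in>{m0..<m1}. \<exists>(u, v, w)\<in>triples n. ({{v, w}} \<subseteq> Gs ! m \<and> ?low (Gs ! m) u v w)
        \<and> {u, v} \<in> Gs ! Suc m - Gs ! m)" for Gs :: "nat set set list"
  define Y4 where "Y4 m Gs \<longleftrightarrow> (\<exists>S. S \<subseteq> {..<n} \<and> 48 < card S \<and> 100 * card S \<le> n \<and>
         card S \<le> card (induced_edges (Gs ! m) S) + 1 \<and> card (boundary (Gs ! m) S) \<le> 2 * card (induced_edges (Gs ! m) S))"
      for m and Gs :: "nat set set list"
  define Y5 where "Y5 m Gs \<longleftrightarrow> (\<exists>S. S \<subseteq> {..<n} \<and> n < 100 * card S \<and> 2 * card S \<le> n \<and>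
         real (card (boundary (Gs ! m) S)) \<le> 2 * c * real (card (induced_edges (Gs ! m) S)))"
      for m and Gs :: "nat set set list"
  have pq: "p \<le> real m / real N" if "m0 \<le> m" for m
    using that by (auto intro!: order_trans[OF p(2) divide_right_mono])
  have m0q: "real m0 / real N \<le> q" using m by (auto intro!: order_trans[OF divide_right_mono q])
  have b1: "measure_pmf.prob ?M {Gs. X1 Gs} \<le> ?b1"
    unfolding X1_def N_def using m p' q N_def
    by (intro prob_exists_low_triple[where F = "\<lambda>u v w. {}"]) auto
  have b2: "measure_pmf.prob ?M {Gs. X2 Gs} \<le> ?b2"
    unfolding X2_def N_def using m p m0q N_def
    by (intro prob_exists_low_triple[where F = "\<lambda>u v w. {{u, v}, {v, w}}"])
      (auto simp: triples_def doubleton_eq_iff card_insert_if)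
  have b3: "measure_pmf.prob ?M {Gs. X3 Gs} \<le> ?b3"
    unfolding X3_def N_def using m p q N_def by (intro prob_low_path_created) auto
  have b4: "measure_pmf.prob ?M {Gs. \<exists>m\<in>{m0..N}. Y4 m Gs} \<le> ?b4"
  proof -
    have "measure_pmf.prob ?M {Gs. \<exists>m\<in>{m0..N}. Y4 m Gs} \<le> (\<Sum>m\<in>{m0..N}. (real N + 1) * real n ^ 2 * a ^ 48)"
    proof (rule prob_bex_le)
      fix m assume mm: "m \<in> {m0..N}"
      show "measure_pmf.prob ?M {Gs. Y4 m Gs} \<le> (real N + 1) * real n ^ 2 * a ^ 48"
        unfolding Y4_def N_def a_def using mm pq[of m] a
        by (intro prob_exists_medium_cut) (auto simp: N_def a_def)
    qed simp
    also have "\<dots> \<le> ?b4"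
    proof -
      have "real (card {m0..N}) \<le> real N + 1" by simp
      moreover have "0 \<le> (real N + 1) * real n ^ 2 * a ^ 48" by (simp add: a_def)
      ultimately show ?thesis by (simp only: sum_constant) (rule mult_right_mono)
    qed
    finally show ?thesis .
  qed
  have b5: "measure_pmf.prob ?M {Gs. \<exists>m\<in>{m0..N}. Y5 m Gs} \<le> ?b5"
  proof -
    let ?e = "(real N + 1) * 2 ^ n * exp (- (2 / 25 * (1 - c)\<^sup>2 * p * (real n / 100) ^ 2))"
    have "measure_pmf.prob ?M {Gs. \<exists>m\<in>{m0..N}. Y5 m Gs} \<le> (\<Sum>m\<in>{m0..N}. ?e)"
    proof (rule prob_bex_le)
      fix m assume mm: "m \<in> {m0..N}"
      show "measure_pmf.prob ?M {Gs. Y5 m Gs} \<le> ?e"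
        unfolding Y5_def N_def using mm pq[of m] p c
        by (intro prob_exists_large_cut) (auto simp: N_def)
    qed simp
    also have "\<dots> \<le> (real N + 1) * ?e"
    proof -
      have "real (card {m0..N}) \<le> real N + 1" by simp
      moreover have "0 \<le> ?e" by simp
      ultimately show ?thesis by (simp only: sum_constant) (rule mult_right_mono)
    qed
    finally show ?thesis by (simp only: c_def)
  qed
  have "measure_pmf.prob ?M ?bad
     \<le> measure_pmf.prob ?M {Gs. X1 Gs \<or> X2 Gs \<or> X3 Gs \<or> (\<exists>m\<in>{m0..N}. Y4 m Gs) \<or> (\<exists>m\<in>{m0..N}. Y5 m Gs)}"
  proof (rule prob_le_on_support)
    fix Gs assume Gs: "Gs \<in> set_pmf ?M" and "Gs \<in> ?bad"
    then obtain m C where mC: "m0 \<le> m" "m \<le> N" "C \<in> components {..<n} (Gs ! m)"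
      "\<not> resilient \<alpha> connected_graph C (induced_edges (Gs ! m) C)" by auto
    have sub: "Gs ! i \<subseteq> nsets {..<n} 2" if "i \<le> N" for i
      using graph_process_nth[OF Gs that] that by (auto simp: N_def nsets_def[of _ i])
    have fin: "finite (Gs ! i)" if "i \<le> N" for i
      by (rule finite_subset[OF sub[OF that]]) (simp add: finite_imp_finite_nsets)
    have "X1 Gs \<or> X2 Gs \<or> X3 Gs \<or> (\<exists>m\<in>{m0..N}. Y4 m Gs) \<or> (\<exists>m\<in>{m0..N}. Y5 m Gs)"
    proof (cases rule: not_resilient_cases[OF sub[OF mC(2)] mC(3) \<alpha> mC(4), case_names triple medium large])
      case (triple u v w)
      show ?thesis
      proof (cases "m \<le> m1")
        case True
        have "X2 Gs \<or> X3 Gs" unfolding X2_def X3_def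
        proof (rule low_path_emerges[where G = "\<lambda>i. Gs ! i" and M = N])
          show "\<exists>e. Gs ! Suc i = insert e (Gs ! i)" if "i < N" for i
            using graph_process_nth_Suc[OF Gs that] by (simp add: N_def)
        qed (use fin triple True m mC in auto)
        then show ?thesis by blast
      next
        case False
        have "Gs ! m1 \<subseteq> Gs ! m" using graph_process_mono[OF Gs] False mC(2) by (simp add: N_def)
        then have "card (boundary (Gs ! m1) {u, v, w}) \<le> card (boundary (Gs ! m) {u, v, w})"
          using fin[OF mC(2)] by (intro card_mono boundary_mono) (auto simp: boundary_def)
        then have "{} \<subseteq> Gs ! m1 \<and> ?low (Gs ! m1) u v w" using triple by simp
        then have "X1 Gs" unfolding X1_def using triple(1) by (intro bexI[of _ "(u, v, w)"]) simp_all
        then show ?thesis by blast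
      qed
    next
      case (medium S)
      then have "Y4 m Gs" unfolding Y4_def by blast
      then show ?thesis using mC by auto
    next
      case (large S)
      then have "Y5 m Gs" unfolding Y5_def c_def by blast
      then show ?thesis using mC by auto
    qed
    then show "Gs \<in> {Gs. X1 Gs \<or> X2 Gs \<or> X3 Gs \<or> (\<exists>m\<in>{m0..N}. Y4 m Gs) \<or> (\<exists>m\<in>{m0..N}. Y5 m Gs)}" by simp
  qed
  also have "\<dots> \<le> ?b1 + (?b2 + (?b3 + (?b4 + ?b5)))"
    by (intro prob_disj_le b1 b2 b3 b4 b5)
  finally show ?thesis .
qed

section \<open>Asymptotics of the five error terms\<close>

lemma low_bound_eq:
  assumes "3 \<le> n"
  shows "low_bound k f n p (4 * ln (real n) / real n) = (real k + 1) * exp (2 * real k + real f) *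
     ((1 + 3 * (real n - 3) * (4 * ln (real n) / real n)) powr real k * (4 * ln (real n) / real n) ^ f
       * exp (- (3 * (real n - 3) * p)))"
proof -
  have "0 < 1 + 3 * (real n - 3) * (4 * ln (real n) / real n)"
    using assms by (intro add_pos_nonneg) auto
  then show ?thesis using assms by (simp add: low_bound_def powr_realpow of_nat_diff mult_ac)
qed

text \<open>The cut argument works with a resilience constant of at least 0 and below 1 / 2, hence
  the upper bound on \<epsilon>.\<close>

lemma prob_resilient_tendsto_1:
  fixes \<epsilon> :: real
  assumes \<epsilon>: "0 < \<epsilon>" "\<epsilon> < 1 / 2"
  shows "(\<lambda>n. measure_pmf.prob (graph_process n (n choose 2))
            {Gs. \<forall>m::nat. (1 + \<epsilon>) / 6 * real n * ln (real n) \<le> real m \<and> m \<le> n choose 2 \<longrightarrow>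
                   (\<forall>C\<in>components {..<n} (Gs ! m).
                      resilient (1 / 2 - \<epsilon>) connected_graph C (induced_edges (Gs ! m) C))})
         \<longlonglongrightarrow> 1" (is "?P \<longlonglongrightarrow> 1")
proof -
  \<comment> \<open>Lower bounds for the density at times \<open>m0\<close> and \<open>m1\<close>,
    with n in place of n - 1 in the denominator, and an upper bound at \<open>m1\<close> with twice
    the leading constant, which absorbs the ceiling.\<close>
  define p p' q where "p n = (1 + \<epsilon>) / 3 * ln (real n) / real n" and "p' n = 2 * ln (real n) / real n"
    and "q n = 4 * ln (real n) / real n" for n :: nat
  define m0 m1 where "m0 n = nat \<lceil>(1 + \<epsilon>) / 6 * real n * ln (real n)\<rceil>" and "m1 n = nat \<lceil>real n * ln (real n)\<rceil>" for n :: nat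
  define \<alpha> where "\<alpha> = 1 / 2 - \<epsilon>"
  define \<kappa> where "\<kappa> = 2 / 25 * (1 - \<alpha> / (1 - \<alpha>))\<^sup>2"
  have \<alpha>: "0 \<le> \<alpha>" "\<alpha> < 1 / 2" using \<epsilon> by (auto simp: \<alpha>_def)
  have "\<alpha> / (1 - \<alpha>) < 1" using \<alpha> by (simp add: divide_less_eq)
  then have \<kappa>: "\<kappa> > 0" unfolding \<kappa>_def by (intro mult_pos_pos zero_less_power) auto
  let ?K = "6912 :: nat"
  \<comment> \<open>To \<open>real_asymp\<close> this is an arbitrary positive real exponent. In the
    same spirit the constants \<open>C f\<close> are split off from the terms that contain
    \<open>L\<close>.\<close>
  define k where "k = real ?K"
  have k: "k > 0" by (simp add: k_def)
  define C where "C f = (real ?K + 1) * exp (2 * real ?K + real f)" for f :: nat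
  define L where "L f P x = (1 + 3 * (x - 3) * (4 * ln x / x)) powr k * (4 * ln x / x) ^ f * exp (- (3 * (x - 3) * P))"
    for f :: nat and P x :: real
  \<comment> \<open>Up to logarithms and constants, \<open>T1\<close> is x powr (3 - 6),
    \<open>T2\<close> is x powr (3 - 2 - (1 + \<epsilon>)), \<open>T3\<close> is x powr (1 + 3 - 1 -
    (1 + \<epsilon>) - 2) and \<open>T4\<close> is x powr (6 - 8). In \<open>T5\<close> the exponent
    is of order - x ln x and beats 2 powr x.\<close>
  define T1 where "T1 x = C 0 * (x ^ 3 * L 0 (2 * ln x / x) x)" for x
  define T2 where "T2 x = C 2 * (x ^ 3 * L 2 ((1 + \<epsilon>) / 3 * ln x / x) x)" for x
  define T3 where "T3 x = C 1 * (2 * x * ln x * (x ^ 3 * (L 1 ((1 + \<epsilon>) / 3 * ln x / x) x / (x ^ 2 / 4))))" for x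
  define T4 where "T4 x = x ^ 2 * (x ^ 2 * x ^ 2 * (100 * exp 1 * x powr (- 1 / 6)) ^ 48)" for x :: real
  define T5 where "T5 x = x ^ 2 * (x ^ 2 * 2 powr x * exp (- (\<kappa> * (ln x / (3 * x)) * (x / 100) ^ 2)))" for x :: real
  have lim: "((\<lambda>n. T1 (real n) + (T2 (real n) + (T3 (real n) + (T4 (real n) + T5 (real n))))) \<longlongrightarrow> 0) sequentially"
  proof -
    have t1: "((\<lambda>n. T1 (real n)) \<longlongrightarrow> 0) sequentially"
      unfolding T1_def L_def power_0 using k by (intro tendsto_mult_right_zero) real_asymp
    have t2: "((\<lambda>n. T2 (real n)) \<longlongrightarrow> 0) sequentially"
      unfolding T2_def L_def using k \<epsilon>(1) by (intro tendsto_mult_right_zero) real_asymp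
    have t3: "((\<lambda>n. T3 (real n)) \<longlongrightarrow> 0) sequentially"
      unfolding T3_def L_def using k \<epsilon>(1) by (intro tendsto_mult_right_zero) real_asymp
    have t4: "((\<lambda>n. T4 (real n)) \<longlongrightarrow> 0) sequentially" unfolding T4_def by real_asymp
    have t5: "((\<lambda>n. T5 (real n)) \<longlongrightarrow> 0) sequentially" unfolding T5_def using \<kappa> by real_asymp
    show ?thesis by (rule tendsto_eq_rhs, (rule tendsto_add t1 t2 t3 t4 t5)+) simp
  qed
  have ev: "eventually (\<lambda>n. 1 - ?P n \<le> T1 (real n) + (T2 (real n) + (T3 (real n) + (T4 (real n) + T5 (real n))))) sequentially"
  proof -
    have e1: "eventually (\<lambda>n. real n * ln (real n) + 1 < real n * (real n - 1) / 2) sequentially" by real_asymp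
    have e2: "eventually (\<lambda>n. real n * ln (real n) + 1 \<le> 4 * ln (real n) / real n * (real n * (real n - 1) / 2)) sequentially"
      by real_asymp
    have e3: "eventually (\<lambda>n. 100 * exp 1 * real n powr (- 1 / 6) \<le> 1) sequentially" by real_asymp
    have e4: "eventually (\<lambda>n. real n ^ 2 / 4 \<le> real n * (real n - 1) / 2 - (real n * ln (real n) + 1)) sequentially"
      by real_asymp
    have e5: "eventually (\<lambda>n. real n * ln (real n) + 1 \<le> 2 * real n * ln (real n)) sequentially" by real_asymp
    have e6: "eventually (\<lambda>n. real n * (real n - 1) / 2 + 1 \<le> real n ^ 2) sequentially" by real_asymp
    show ?thesis
      using e1 e2 e3 e4 e5 e6 eventually_ge_at_top[of "3::nat"]
    proof eventually_elim
      case (elim n)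
      define x where "x = real n"
      define N where "N = n choose 2"
      have x: "x \<ge> 3" using elim(7) by (simp add: x_def)
      have lx: "ln x > 0" using x by simp
      have N: "real N = x * (x - 1) / 2" by (simp add: N_def real_choose_two x_def)
      have Npos: "real N > 0" using x by (simp add: N)
      have nat_ceil: "y \<le> real (nat \<lceil>y\<rceil>) \<and> real (nat \<lceil>y\<rceil>) \<le> y + 1" if "y \<ge> 0" for y :: real
        using that by linarith
      have xl: "0 \<le> x * ln x" using x lx by simp
      have m1: "x * ln x \<le> real (m1 n)" "real (m1 n) \<le> x * ln x + 1"
        using nat_ceil[OF xl] by (auto simp: m1_def x_def)
      have m0: "(1 + \<epsilon>) / 6 * x * ln x \<le> real (m0 n)"
        unfolding m0_def x_def by (rule real_nat_ceiling_ge)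
      have m01: "m0 n \<le> m1 n" unfolding m0_def m1_def
      proof (intro nat_mono ceiling_mono)
        have "(1 + \<epsilon>) / 6 * (x * ln x) \<le> 1 * (x * ln x)" using \<epsilon> xl by (intro mult_right_mono) auto
        then show "(1 + \<epsilon>) / 6 * real n * ln (real n) \<le> real n * ln (real n)" by (simp add: x_def)
      qed
      have m1N: "m1 n < N" using m1(2) elim(1) N by (simp add: x_def)
      have p0: "0 \<le> p n" "0 \<le> q n" using x lx \<epsilon> by (auto simp: p_def q_def x_def)
      have pm: "p n \<le> real (m0 n) / real N"
      proof -
        have "p n * real N = (1 + \<epsilon>) / 6 * ln x * (x - 1)"
          using x by (simp add: p_def N flip: x_def)
        also have "\<dots> \<le> (1 + \<epsilon>) / 6 * ln x * x" using \<epsilon> lx by (intro mult_left_mono) auto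
        also have "\<dots> \<le> real (m0 n)" using m0 by (simp add: mult_ac)
        finally show ?thesis using Npos by (simp add: pos_le_divide_eq)
      qed
      have p'm: "p' n \<le> real (m1 n) / real N"
      proof -
        have "p' n * real N = ln x * (x - 1)"
          using x by (simp add: p'_def N flip: x_def)
        also have "\<dots> \<le> ln x * x" using lx by (intro mult_left_mono) auto
        also have "\<dots> \<le> real (m1 n)" using m1 by (simp add: mult_ac)
        finally show ?thesis using Npos by (simp add: pos_le_divide_eq)
      qed
      have qm: "real (m1 n) / real N \<le> q n"
        using order_trans[OF m1(2) elim(2)[folded x_def]] Npos by (simp add: pos_divide_le_eq q_def N x_def)
      define a where "a = 100 * exp 1 * exp (- (p n * real n / 2))"
      have a: "0 \<le> a" "a \<le> 100 * exp 1 * x powr (- 1 / 6)"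
      proof -
        have "p n * real n / 2 = (1 + \<epsilon>) / 6 * ln x" using x by (simp add: p_def x_def)
        also have "\<dots> \<ge> 1 / 6 * ln x" using \<epsilon> lx by (intro mult_right_mono) auto
        finally have "exp (- (p n * real n / 2)) \<le> exp (- 1 / 6 * ln x)" by simp
        also have "\<dots> = x powr (- 1 / 6)" using x by (simp add: powr_def)
        finally show "a \<le> 100 * exp 1 * x powr (- 1 / 6)" unfolding a_def by (intro mult_left_mono) auto
      qed (simp add: a_def)
      then have a1: "a \<le> 1" using elim(3) by (simp add: x_def)
      have N1: "real N + 1 \<le> x ^ 2" using elim(6) by (simp add: N x_def)
      have Nm: "x ^ 2 / 4 \<le> real (N - m1 n)" using elim(4) m1(2) m1N N by (simp add: x_def of_nat_diff)
      have low: "low_bound ?K f n P (q n) = C f * L f P x" for f P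
        using low_bound_eq[of n ?K f P] elim(7) unfolding L_def C_def q_def x_def k_def by simp
      have low0: "0 \<le> low_bound ?K f n P (q n)" for f P by (rule low_bound_nonneg[OF p0(2)])
      let ?bad = "{Gs. \<exists>m\<in>{m0 n..N}. \<exists>C\<in>components {..<n} (Gs ! m).
         \<not> resilient \<alpha> connected_graph C (induced_edges (Gs ! m) C)}"
      have "1 - ?P n = measure_pmf.prob (graph_process n N) ?bad"
      proof -
        have "{Gs. \<forall>m::nat. (1 + \<epsilon>) / 6 * real n * ln (real n) \<le> real m \<and> m \<le> n choose 2 \<longrightarrow>
                   (\<forall>C\<in>components {..<n} (Gs ! m).
                      resilient (1 / 2 - \<epsilon>) connected_graph C (induced_edges (Gs ! m) C))} = UNIV - ?bad"
          by (auto simp: m0_def N_def \<alpha>_def nat_le_iff ceiling_le_iff)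
        then show ?thesis using measure_pmf.prob_compl[of ?bad "graph_process n N"] by (simp add: N_def)
      qed
      also have "\<dots> \<le> real n ^ 3 * low_bound ?K 0 n (p' n) (q n)
        + (real n ^ 3 * low_bound ?K 2 n (p n) (q n)
        + (real (m1 n) * (real n ^ 3 * (low_bound ?K 1 n (p n) (q n) / real (N - m1 n)))
        + ((real N + 1) * ((real N + 1) * real n ^ 2 * a ^ 48)
        + (real N + 1) * ((real N + 1) * 2 ^ n *
            exp (- (2 / 25 * (1 - \<alpha> / (1 - \<alpha>))\<^sup>2 * p n * (real n / 100) ^ 2))))))"
        unfolding N_def a_def using m01 m1N \<alpha> p0 pm p'm qm a1 
        by (intro prob_not_resilient_le) (auto simp: N_def a_def)
      also have "\<dots> \<le> T1 x + (T2 x + (T3 x + (T4 x + T5 x)))"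
      proof (intro add_mono)
        show "real n ^ 3 * low_bound ?K 0 n (p' n) (q n) \<le> T1 x"
          unfolding low T1_def p'_def x_def by simp
        show "real n ^ 3 * low_bound ?K 2 n (p n) (q n) \<le> T2 x"
          unfolding low T2_def p_def x_def by simp
        show "real (m1 n) * (real n ^ 3 * (low_bound ?K 1 n (p n) (q n) / real (N - m1 n))) \<le> T3 x"
        proof -
          have "real (m1 n) * (real n ^ 3 * (low_bound ?K 1 n (p n) (q n) / real (N - m1 n)))
            \<le> (2 * x * ln x) * (x ^ 3 * (low_bound ?K 1 n (p n) (q n) / (x ^ 2 / 4)))"
          proof (intro mult_mono divide_left_mono)
            show "real (m1 n) \<le> 2 * x * ln x" using m1(2) elim(5) by (simp add: x_def)
            show "0 < real (N - m1 n) * (x ^ 2 / 4)" using m1N x by simp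
          qed (use Nm low0 xl x_def in auto)
          also have "\<dots> = T3 x" unfolding low T3_def p_def x_def by simp
          finally show ?thesis .
        qed
        show "(real N + 1) * ((real N + 1) * real n ^ 2 * a ^ 48) \<le> T4 x"
          unfolding T4_def using N1 a by (intro mult_mono power_mono) (auto simp: x_def)
        show "(real N + 1) * ((real N + 1) * 2 ^ n *
            exp (- (2 / 25 * (1 - \<alpha> / (1 - \<alpha>))\<^sup>2 * p n * (real n / 100) ^ 2))) \<le> T5 x"
          unfolding T5_def
        proof (intro mult_mono N1 iffD2[OF exp_le_cancel_iff])
          show "(2::real) ^ n \<le> 2 powr x" by (simp add: x_def powr_realpow)
          have "ln x / (3 * x) \<le> p n" using x lx \<epsilon> by (simp add: p_def divide_simps flip: x_def)
          then have "\<kappa> * (ln x / (3 * x)) * (x / 100) ^ 2 \<le> \<kappa> * p n * (x / 100) ^ 2"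
            using \<kappa> by (intro mult_right_mono mult_left_mono) auto
          then show "- (2 / 25 * (1 - \<alpha> / (1 - \<alpha>))\<^sup>2 * p n * (real n / 100) ^ 2) \<le> - (\<kappa> * (ln x / (3 * x)) * (x / 100) ^ 2)"
            by (simp add: \<kappa>_def x_def)
        qed auto
      qed
      finally show ?case by (simp add: x_def)
    qed
  qed
  have "((\<lambda>n. 1 - ?P n) \<longlongrightarrow> 0) sequentially"
    by (rule tendsto_sandwich[OF _ ev tendsto_const lim]) simp
  then have "((\<lambda>n. 1 - (1 - ?P n)) \<longlongrightarrow> 1 - 0) sequentially" by (intro tendsto_diff tendsto_const)
  then show ?thesis by simp
qed

theorem theorem1p2:
  fixes \<epsilon> :: real
  assumes "\<epsilon> > 0"
  shows "(\<lambda>n. measure_pmf.prob (graph_process n (n choose 2))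
            {Gs. \<forall>m::nat. (1 + \<epsilon>) / 6 * real n * ln (real n) \<le> real m \<and> m \<le> n choose 2 \<longrightarrow>
                   (\<forall>C. largest_component {..<n} (Gs ! m) C \<longrightarrow>
                      resilient (1 / 2 - \<epsilon>) connected_graph C (induced_edges (Gs ! m) C))})
         \<longlonglongrightarrow> 1"
proof -
  \<comment> \<open>A smaller \<epsilon> lowers the threshold and raises the resilience constant, so
    the statement for \<delta> implies the one for \<epsilon>. The cap 1 / 4 keeps 1 / 2 - \<delta>
    positive.\<close>
  define \<delta> where "\<delta> = min \<epsilon> (1 / 4)"
  have \<delta>: "0 < \<delta>" "\<delta> < 1 / 2" "\<delta> \<le> \<epsilon>" using assms by (auto simp: \<delta>_def)
  have res: "resilient (1 / 2 - \<epsilon>) P V E" if "resilient (1 / 2 - \<delta>) P V E"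
    for P :: "nat set \<Rightarrow> nat set set \<Rightarrow> bool" and V E
  proof -
    have "(1 / 2 - \<epsilon>) * real (degree_in E v) \<le> (1 / 2 - \<delta>) * real (degree_in E v)" for v
      using \<delta> by (intro mult_right_mono) auto
    then show ?thesis using that unfolding resilient_def by (meson order_trans)
  qed
  show ?thesis
  proof (rule tendsto_sandwich[OF always_eventually always_eventually prob_resilient_tendsto_1[OF \<delta>(1,2)] tendsto_const];
         intro allI)
    fix n :: nat
    have "0 \<le> real n * ln (real n)" by (cases n) auto
    then have "(1 + \<delta>) / 6 * (real n * ln (real n)) \<le> (1 + \<epsilon>) / 6 * (real n * ln (real n))"
      using \<delta> by (intro mult_right_mono) auto
    then have "(1 + \<delta>) / 6 * real n * ln (real n) \<le> real m"
      if "(1 + \<epsilon>) / 6 * real n * ln (real n) \<le> real m" for m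
      using that by (simp add: mult.assoc)
    then show "measure_pmf.prob (graph_process n (n choose 2))
            {Gs. \<forall>m::nat. (1 + \<delta>) / 6 * real n * ln (real n) \<le> real m \<and> m \<le> n choose 2 \<longrightarrow>
                   (\<forall>C\<in>components {..<n} (Gs ! m).
                      resilient (1 / 2 - \<delta>) connected_graph C (induced_edges (Gs ! m) C))}
       \<le> measure_pmf.prob (graph_process n (n choose 2))
            {Gs. \<forall>m::nat. (1 + \<epsilon>) / 6 * real n * ln (real n) \<le> real m \<and> m \<le> n choose 2 \<longrightarrow>
                   (\<forall>C. largest_component {..<n} (Gs ! m) C \<longrightarrow>
                      resilient (1 / 2 - \<epsilon>) connected_graph C (induced_edges (Gs ! m) C))}"
      using res by (intro measure_pmf.finite_measure_mono) (auto simp: largest_component_def)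
  qed simp
qed

end
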